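(* For every fixed integer $t\ge2$, every $n$-vertex graph $G$ satisfies $\mathrm{cov}_t(G)\le(1+o(1))\,\mathrm{cov}_t(T_{n,t})$, where the $o(1)$ term tends to $0$ as $n\to\infty$; that is, for every $\epsilon>0$ there is $n_0$ such that for all $n\ge n_0$ and every $n$-vertex graph $G$, $\mathrm{cov}_t(G)\le(1+\epsilon)\mathrm{cov}_t(T_{n,t})$.
   Context: All graphs are finite and simple. A clique of a graph $G$ is a nonempty set of pairwise adjacent vertices; $\mathcal{K}(G)$ denotes the set of cliques of $G$ and $\mathcal{K}_t(G)$ the set of cliques with exactly $t$ vertices. A $t$-clique cover of $G$ is a function $f:\mathcal{K}(G)\to\{0,1\}$ such that for every $T\in\mathcal{K}_t(G)$, $\sum_{K\in\mathcal{K}(G),\,T\subseteq K}f(K)\ge1$. $\mathrm{cov}_t(G)$ is the minimum of $\sum_{K}f(K)$ over all $t$-clique covers $f$ of $G$ (i.e. the minimum number of cliques of $G$ such that every $t$-clique of $G$ is contained in one of them). For $n\ge k$, $T_{n,k}$ denotes the Turán graph: the complete $k$-partite graph on $n$ vertices whose part sizes differ by at most one. *)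

theory Defs
  imports Complex_Main "HOL-Library.Ramsey"
begin

text \<open>A graph is given by its vertex set and its set of edges, the latter being two-element
  vertex sets, as in \<^theory>\<open>HOL-Library.Ramsey\<close>.\<close>

definition simple_graph :: "'a set \<Rightarrow> 'a set set \<Rightarrow> bool" where
  "simple_graph V E \<longleftrightarrow> finite V \<and> E \<subseteq> nsets V 2"

text \<open>The predicate \<^const>\<open>clique\<close> also holds of the empty set, which is excluded here.\<close>

definition cliques :: "'a set \<Rightarrow> 'a set set \<Rightarrow> 'a set set" where
  "cliques V E = {K. K \<subseteq> V \<and> K \<noteq> {} \<and> clique K E}"

definition cliques_of_size :: "nat \<Rightarrow> 'a set \<Rightarrow> 'a set set \<Rightarrow> 'a set set" where
  "cliques_of_size t V E = {K \<in> cliques V E. card K = t}"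

text \<open>The values of \<open>f\<close> outside \<open>cliques V E\<close> are irrelevant.\<close>

definition clique_cover :: "nat \<Rightarrow> 'a set \<Rightarrow> 'a set set \<Rightarrow> ('a set \<Rightarrow> nat) \<Rightarrow> bool" where
  "clique_cover t V E f \<longleftrightarrow>
     (\<forall>K \<in> cliques V E. f K \<in> {0, 1}) \<and>
     (\<forall>T \<in> cliques_of_size t V E. (\<Sum>K | K \<in> cliques V E \<and> T \<subseteq> K. f K) \<ge> 1)"

definition cov :: "nat \<Rightarrow> 'a set \<Rightarrow> 'a set set \<Rightarrow> nat" where
  "cov t V E = (LEAST m. \<exists>f. clique_cover t V E f \<and> m = (\<Sum>K \<in> cliques V E. f K))"

text \<open>The Turan graph on the vertices \<open>0, \<dots>, n - 1\<close>; its parts are the residue classes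
  modulo \<open>k\<close>. The definition is meant for \<open>n \<ge> k \<ge> 1\<close>.\<close>

definition turan_edges :: "nat \<Rightarrow> nat \<Rightarrow> nat set set" where
  "turan_edges n k = {{u, v} | u v. u < n \<and> v < n \<and> u mod k \<noteq> v mod k}"

lemma simple_graph_turan: "simple_graph {..<n} (turan_edges n k)"
  by (auto simp: simple_graph_def turan_edges_def nsets_def card_2_iff)

lemma card_turan_part:
  fixes i k n :: nat
  assumes "i < k"
  shows "card {v. v < n \<and> v mod k = i} = n div k + (if i < n mod k then 1 else 0)"
proof (induction n)
  case (Suc n)
  have "{v. v < Suc n \<and> v mod k = i} =
      (if n mod k = i then insert n {v. v < n \<and> v mod k = i} else {v. v < n \<and> v mod k = i})"
    by (auto simp: less_Suc_eq)
  then have "card {v. v < Suc n \<and> v mod k = i} =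
      card {v. v < n \<and> v mod k = i} + (if n mod k = i then 1 else 0)"
    by simp
  then show ?case
    using Suc assms by (auto simp: mod_Suc div_Suc)
qed simp

lemma turan_parts_balanced:
  fixes i j k n :: nat
  assumes "i < k" "j < k"
  shows "card {v. v < n \<and> v mod k = i} \<le> card {v. v < n \<and> v mod k = j} + 1"
  unfolding card_turan_part[OF assms(1)] card_turan_part[OF assms(2)] by simp

lemma turan_part_nonempty:
  fixes i k n :: nat
  assumes "i < k" "k \<le> n"
  shows "{v. v < n \<and> v mod k = i} \<noteq> {}"
proof -
  have "i \<in> {v. v < n \<and> v mod k = i}"
    using assms by simp
  then show ?thesis
    by blast
qed

lemma cov_attained:
  assumes "simple_graph V E"
  shows "\<exists>f. clique_cover t V E f \<and> cov t V E = (\<Sum>K \<in> cliques V E. f K)"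
proof -
  have fin: "finite (cliques V E)"
    using assms by (auto simp: simple_graph_def cliques_def intro: finite_subset[of _ "Pow V"])
  have "clique_cover t V E (\<lambda>_. 1)"
    unfolding clique_cover_def
  proof (intro conjI ballI)
    fix T assume "T \<in> cliques_of_size t V E"
    then have "T \<in> {K. K \<in> cliques V E \<and> T \<subseteq> K}"
      by (auto simp: cliques_of_size_def)
    moreover have "finite {K. K \<in> cliques V E \<and> T \<subseteq> K}"
      using fin by simp
    ultimately have "card {K. K \<in> cliques V E \<and> T \<subseteq> K} > 0"
      using card_gt_0_iff by blast
    then show "(\<Sum>K | K \<in> cliques V E \<and> T \<subseteq> K. 1) \<ge> (1::nat)"
      by simp
  qed simp
  then have "\<exists>m f. clique_cover t V E f \<and> m = (\<Sum>K \<in> cliques V E. f K)"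
    by blast
  then show ?thesis
    unfolding cov_def by (rule LeastI_ex)
qed

lemma cov_le:
  assumes "clique_cover t V E f"
  shows "cov t V E \<le> (\<Sum>K \<in> cliques V E. f K)"
  unfolding cov_def using assms by (blast intro: Least_le)

end

theory Submission
  imports Defs "HOL-Analysis.Convex"
begin

text \<open>
  Every clique of the Turan graph contains at most one \<open>t\<close>-clique, so its cover number is the number
  of its \<open>t\<close>-cliques, which is at least \<open>(n div t) ^ t\<close>. It remains to cover the \<open>t\<close>-cliques of any graph
  by \<open>(1 + o(1)) (n / t) ^ t\<close> cliques.

  Fractionally this is a Motzkin--Straus argument: for weights \<open>w\<close> on the \<open>t\<close>-cliques, the polynomial
  \<open>\<Sum>T. w T * (\<Prod>v\<in>T. x v)\<close> is linear along exchanges between nonadjacent vertices, so on the simplex it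
  is maximal at a point supported on a clique \<open>K\<close>, where it is at most \<open>t\<close> to the power \<open>- t\<close> times the
  weight inside \<open>K\<close>. Comparing with the uniform point, some clique carries a \<open>(t / n) ^ t\<close> fraction of
  the total weight, and the multiplicative weights method turns this into a fractional cover.

  To make the cover integral, fix a large \<open>M\<close> and average fractional covers of the induced subgraphs on
  all \<open>M\<close>-subsets of the vertices. This is a weighted hypergraph on the \<open>t\<close>-cliques with bounded edge
  size, all degrees 1, and codegrees \<open>O(1 / n)\<close>. The Roedl nibble (finitely many rounds, each analysed by
  first and second moments) then yields an integral cover of nearly the same total weight.
\<close>

subsection \<open>Fractional covers\<close>

text \<open>A fractional cover of the whole graph cannot be rounded directly: it may use cliques on
  almost all vertices, which contain unboundedly many t-cliques and can keep two of them together
  with weight 1. Cliques inside \<open>M\<close>-subsets give hyperedges of size at most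
  \<open>2 ^ M\<close>, and spreading the cover over all samples makes the codegrees small. The
  price is the ratio of \<open>(M / t) ^ t * (n choose t) / (M choose t)\<close> to
  \<open>(n / t) ^ t\<close>, which tends to 1 as \<open>M\<close> grows; hence \<open>M\<close> is
  fixed before \<open>n\<close>. The nibble leaves an error proportional to the number of t-cliques,
  not to the weight of the fractional cover. This is affordable because the target
  \<open>(n / t) ^ t\<close> is a constant fraction of \<open>n ^ t\<close>. Cliques contain
  different numbers of t-cliques, so the hypergraph is not uniform and a round does not shrink all
  degrees by one common factor. Rescaling each weight according to the size of its hyperedge repairs
  this.\<close>

definition clique_poly :: "'a set set \<Rightarrow> ('a set \<Rightarrow> real) \<Rightarrow> ('a \<Rightarrow> real) \<Rightarrow> 'a set \<Rightarrow> real" where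
  "clique_poly \<T> w x S = (\<Sum>T | T \<in> \<T> \<and> T \<subseteq> S. w T * (\<Prod>v\<in>T. x v))"

text \<open>No clique contains both \<open>u\<close> and \<open>v\<close>, so the polynomial is linear along the exchange of
  weight between them and one of the two extreme exchanges does not decrease it.\<close>

lemma clique_poly_shift:
  assumes "finite \<T>" "\<And>T. T \<in> \<T> \<Longrightarrow> finite T \<and> \<not> (u \<in> T \<and> v \<in> T)" "u \<in> S" "v \<in> S" "u \<noteq> v"
    and xv: "x v \<ge> 0"
    and le: "(\<Sum>T | T \<in> \<T> \<and> T \<subseteq> S \<and> v \<in> T. w T * (\<Prod>z\<in>T-{v}. x z))
           \<le> (\<Sum>T | T \<in> \<T> \<and> T \<subseteq> S \<and> u \<in> T. w T * (\<Prod>z\<in>T-{u}. x z))" (is "?Av \<le> ?Au")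
  shows "clique_poly \<T> w x S \<le> clique_poly \<T> w (x(u := x u + x v)) (S - {v})"
proof -
  let ?U = "{T \<in> \<T>. T \<subseteq> S \<and> u \<in> T}" and ?V = "{T \<in> \<T>. T \<subseteq> S \<and> v \<in> T}"
    and ?R = "{T \<in> \<T>. T \<subseteq> S \<and> u \<notin> T \<and> v \<notin> T}"
  let ?y = "x(u := x u + x v)"
  have fin: "finite ?U" "finite ?V" "finite ?R"
    using assms(1) by auto
  have R: "(\<Sum>T\<in>?R. w T * (\<Prod>z\<in>T. ?y z)) = (\<Sum>T\<in>?R. w T * (\<Prod>z\<in>T. x z))"
  proof (rule sum.cong[OF refl])
    fix T assume "T \<in> ?R"
    then have "(\<Prod>z\<in>T. ?y z) = (\<Prod>z\<in>T. x z)"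
      by (intro prod.cong) auto
    then show "w T * (\<Prod>z\<in>T. ?y z) = w T * (\<Prod>z\<in>T. x z)" by (rule arg_cong)
  qed
  have split1: "w T * (\<Prod>z\<in>T. x z) = x a * (w T * (\<Prod>z\<in>T-{a}. x z))" if "T \<in> \<T>" "a \<in> T" for T a
    using assms(2)[OF that(1)] that(2) by (subst prod.remove[of _ a]) auto
  have splity: "w T * (\<Prod>z\<in>T. ?y z) = (x u + x v) * (w T * (\<Prod>z\<in>T-{u}. x z))" if "T \<in> \<T>" "u \<in> T" for T
  proof -
    have "(\<Prod>z\<in>T. ?y z) = ?y u * (\<Prod>z\<in>T-{u}. ?y z)"
      using assms(2)[OF that(1)] that(2) by (subst prod.remove[of _ u]) auto
    also have "(\<Prod>z\<in>T-{u}. ?y z) = (\<Prod>z\<in>T-{u}. x z)"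
      by (intro prod.cong) auto
    finally show ?thesis by simp
  qed
  have eq: "{T. T \<in> \<T> \<and> T \<subseteq> S} = ?R \<union> (?U \<union> ?V)" by auto
  have disj: "?U \<inter> ?V = {}" "?R \<inter> (?U \<union> ?V) = {}"
    using assms(2) by auto
  have "clique_poly \<T> w x S = (\<Sum>T\<in>?R. w T * (\<Prod>z\<in>T. x z))
      + ((\<Sum>T\<in>?U. w T * (\<Prod>z\<in>T. x z)) + (\<Sum>T\<in>?V. w T * (\<Prod>z\<in>T. x z)))"
    unfolding clique_poly_def eq sum.union_disjoint[OF fin(3) finite_UnI[OF fin(1,2)] disj(2)]
      sum.union_disjoint[OF fin(1,2) disj(1)] ..
  also have "(\<Sum>T\<in>?U. w T * (\<Prod>z\<in>T. x z)) = x u * ?Au"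
    unfolding sum_distrib_left by (rule sum.cong[OF refl]) (rule split1, auto)
  also have "(\<Sum>T\<in>?V. w T * (\<Prod>z\<in>T. x z)) = x v * ?Av"
    unfolding sum_distrib_left by (rule sum.cong[OF refl]) (rule split1, auto)
  also have "(\<Sum>T\<in>?R. w T * (\<Prod>z\<in>T. x z)) + (x u * ?Au + x v * ?Av)
      \<le> (\<Sum>T\<in>?R. w T * (\<Prod>z\<in>T. ?y z)) + (x u + x v) * ?Au"
    using mult_left_mono[OF le xv] R by (simp add: algebra_simps)
  also have "(x u + x v) * ?Au = (\<Sum>T\<in>?U. w T * (\<Prod>z\<in>T. ?y z))"
    unfolding sum_distrib_left by (rule sum.cong[OF refl]) (rule splity[symmetric], auto)
  also have "(\<Sum>T\<in>?R. w T * (\<Prod>z\<in>T. ?y z)) + (\<Sum>T\<in>?U. w T * (\<Prod>z\<in>T. ?y z))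
      = (\<Sum>T\<in>?R \<union> ?U. w T * (\<Prod>z\<in>T. ?y z))"
    using fin by (subst sum.union_disjoint) auto
  \<comment> \<open>By nonadjacency the sets in \<open>?U\<close> avoid \<open>v\<close>, so exactly
    the sets through \<open>v\<close> have disappeared.\<close>
  also have "?R \<union> ?U = {T. T \<in> \<T> \<and> T \<subseteq> S - {v}}"
    using assms(2-5) by auto
  finally show ?thesis
    unfolding clique_poly_def .
qed

text \<open>Exchanges take the place of a maximiser on the simplex: each one deletes a vertex of a
  nonadjacent pair and keeps the total mass 1, so after finitely many of them the support is a
  clique.\<close>

lemma clique_poly_le_clique:
  assumes "finite \<T>" "\<And>T. T \<in> \<T> \<Longrightarrow> finite T \<and> clique T E"
    and "finite S" "S \<noteq> {}" "\<And>v. v \<in> S \<Longrightarrow> x v \<ge> 0" "(\<Sum>v\<in>S. x v) = 1"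
  shows "\<exists>K y. K \<subseteq> S \<and> K \<noteq> {} \<and> clique K E \<and> (\<forall>v\<in>K. y v \<ge> 0) \<and> (\<Sum>v\<in>K. y v) = 1 \<and>
           clique_poly \<T> w x S \<le> clique_poly \<T> w y K"
  using assms(3-)
proof (induction "card S" arbitrary: S x rule: less_induct)
  case less
  show ?case
  proof (cases "clique S E")
    case True
    then show ?thesis using less.prems by blast
  next
    case False
    then obtain u v where uv: "u \<in> S" "v \<in> S" "u \<noteq> v" "{u, v} \<notin> E"
      by (auto simp: clique_def)
    \<comment> \<open>\<open>c a\<close> is the coefficient of \<open>x a\<close>. The pair is named
      so that the vertex with the smaller coefficient is the one deleted.\<close>
    define c where "c a = (\<Sum>T | T \<in> \<T> \<and> T \<subseteq> S \<and> a \<in> T. w T * (\<Prod>z\<in>T-{a}. x z))" for a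
    obtain a b where ab: "a \<in> S" "b \<in> S" "a \<noteq> b" "{a, b} \<notin> E" "c b \<le> c a"
      using uv by (metis insert_commute linear)
    let ?y = "x(a := x a + x b)" and ?S = "S - {b}"
    have "finite T \<and> \<not> (a \<in> T \<and> b \<in> T)" if "T \<in> \<T>" for T
      using assms(2)[OF that] ab unfolding clique_def by blast
    then have step: "clique_poly \<T> w x S \<le> clique_poly \<T> w ?y ?S"
      using assms(1) ab less.prems(3) unfolding c_def by (intro clique_poly_shift) auto
    have "(\<Sum>v\<in>?S. ?y v) = ?y a + (\<Sum>v\<in>?S-{a}. ?y v)"
      using ab less.prems(1) by (subst sum.remove[of _ a]) auto
    also have "(\<Sum>v\<in>?S-{a}. ?y v) = (\<Sum>v\<in>?S-{a}. x v)"
      by (intro sum.cong) auto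
    also have "?y a + \<dots> = (\<Sum>v\<in>S. x v)"
      using ab less.prems(1) by (subst sum.remove[of S b], simp, simp, subst sum.remove[of "S-{b}" a]) auto
    finally have sum1: "(\<Sum>v\<in>?S. ?y v) = 1"
      using less.prems by simp
    have "\<exists>K y. K \<subseteq> ?S \<and> K \<noteq> {} \<and> clique K E \<and> (\<forall>v\<in>K. y v \<ge> 0) \<and> (\<Sum>v\<in>K. y v) = 1 \<and>
           clique_poly \<T> w ?y ?S \<le> clique_poly \<T> w y K"
    proof (rule less.hyps)
      show "card ?S < card S"
        using ab less.prems(1) by (meson card_Diff1_less)
    qed (use less.prems ab sum1 in \<open>auto\<close>)
    then show ?thesis
      using step by (meson Diff_subset order_trans)
  qed
qed

lemma prod_le_of_sum_le_one:
  fixes y :: "'a \<Rightarrow> real"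
  assumes "finite T" "card T = t" "t \<ge> 1" "\<And>v. v \<in> T \<Longrightarrow> y v \<ge> 0" "(\<Sum>v\<in>T. y v) \<le> 1"
  shows "(\<Prod>v\<in>T. y v) \<le> (1 / real t) ^ t"
proof -
  have p: "(\<Prod>v\<in>T. y v) \<ge> 0" using assms by (intro prod_nonneg) auto
  have "(\<Prod>v\<in>T. y v) powr (1 / real t) \<le> (\<Sum>v\<in>T. y v / real t)"
    using arith_geom_mean[of T y] assms by fastforce
  also have "\<dots> \<le> 1 / real t"
    using assms by (simp flip: sum_divide_distrib add: divide_right_mono)
  finally have "((\<Prod>v\<in>T. y v) powr (1 / real t)) ^ t \<le> (1 / real t) ^ t"
    by (intro power_mono) auto
  also have "((\<Prod>v\<in>T. y v) powr (1 / real t)) ^ t = (\<Prod>v\<in>T. y v)"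
    using p assms(3) by (cases "(\<Prod>v\<in>T. y v) = 0") (simp_all add: powr_powr flip: powr_realpow)
  finally show ?thesis .
qed

lemma finite_cliques: "finite V \<Longrightarrow> finite (cliques V E)"
  by (rule finite_subset[of _ "Pow V"]) (auto simp: cliques_def)

lemma finite_cliques_of_size: "finite V \<Longrightarrow> finite (cliques_of_size t V E)"
  by (simp add: cliques_of_size_def finite_cliques)

text \<open>By LP duality, such a clique for every weighting is equivalent to a fractional cover of
  total weight \<open>(card V / t) ^ t\<close>. Multiplicative weights make the duality
  constructive, using this lemma as the oracle.\<close>

lemma heavy_clique:
  fixes w :: "'a set \<Rightarrow> real"
  assumes V: "finite V" "V \<noteq> {}" and t: "t \<ge> 1" and w: "\<And>T. T \<in> cliques_of_size t V E \<Longrightarrow> w T \<ge> 0"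
  shows "\<exists>K \<in> cliques V E. (\<Sum>T | T \<in> cliques_of_size t V E \<and> T \<subseteq> K. w T)
           \<ge> (real t / real (card V)) ^ t * (\<Sum>T \<in> cliques_of_size t V E. w T)"
proof -
  let ?\<T> = "cliques_of_size t V E" and ?n = "real (card V)"
  let ?x = "\<lambda>_::'a. 1 / ?n"
  have n: "?n > 0" using V by (simp add: card_gt_0_iff)
  have fin: "finite ?\<T>" using V by (intro finite_cliques_of_size)
  have T: "finite T \<and> clique T E \<and> card T = t \<and> T \<subseteq> V" if "T \<in> ?\<T>" for T
    using that V by (auto simp: cliques_of_size_def cliques_def intro: finite_subset)
  have "\<exists>K y. K \<subseteq> V \<and> K \<noteq> {} \<and> clique K E \<and> (\<forall>v\<in>K. y v \<ge> 0) \<and> (\<Sum>v\<in>K. y v) = 1 \<and>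
           clique_poly ?\<T> w ?x V \<le> clique_poly ?\<T> w y K"
    using fin T V n by (intro clique_poly_le_clique) auto
  then obtain K y where K: "K \<subseteq> V" "K \<noteq> {}" "clique K E" "\<forall>v\<in>K. y v \<ge> 0" "(\<Sum>v\<in>K. y v) = 1"
      and le: "clique_poly ?\<T> w ?x V \<le> clique_poly ?\<T> w y K"
    by blast
  have "(\<Sum>T \<in> ?\<T>. w T) * (1 / ?n) ^ t = clique_poly ?\<T> w ?x V"
    unfolding clique_poly_def sum_distrib_right by (intro sum.cong) (use T in auto)
  also note le
  also have "clique_poly ?\<T> w y K \<le> (\<Sum>T | T \<in> ?\<T> \<and> T \<subseteq> K. w T * (1 / real t) ^ t)"
    unfolding clique_poly_def
  proof (intro sum_mono mult_left_mono prod_le_of_sum_le_one t)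
    fix T assume A: "T \<in> {T. T \<in> ?\<T> \<and> T \<subseteq> K}"
    have "finite K" using K(1) V finite_subset by blast
    then have "sum y T \<le> sum y K" using A K by (intro sum_mono2) auto
    then show "sum y T \<le> 1" using K by simp
  qed (use T K w in auto)
  also have "\<dots> = (\<Sum>T | T \<in> ?\<T> \<and> T \<subseteq> K. w T) * (1 / real t) ^ t"
    by (simp add: sum_distrib_right)
  finally have "(\<Sum>T \<in> ?\<T>. w T) * (1 / ?n) ^ t * real t ^ t \<le> (\<Sum>T | T \<in> ?\<T> \<and> T \<subseteq> K. w T) * (1 / real t) ^ t * real t ^ t"
    by (intro mult_right_mono) auto
  also have "\<dots> = (\<Sum>T | T \<in> ?\<T> \<and> T \<subseteq> K. w T)"
    using t by (simp add: power_divide)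
  finally have "(\<Sum>T | T \<in> ?\<T> \<and> T \<subseteq> K. w T) \<ge> (real t / ?n) ^ t * (\<Sum>T \<in> ?\<T>. w T)"
    by (simp add: power_divide mult_ac)
  then show ?thesis
    using K unfolding cliques_def by blast
qed

text \<open>Each round charges the clique that is heaviest for the current weights; a \<open>t\<close>-clique covered
  \<open>m\<close> times so far has weight \<open>(1 - \<eta>) ^ m\<close>, so a rarely covered one would keep the total large.\<close>

lemma multiplicative_weights:
  assumes V: "finite V" "V \<noteq> {}" and t: "t \<ge> 1" "t \<le> card V" and \<eta>: "0 < \<eta>" "\<eta> < (1::real)"
  shows "\<exists>K. (\<forall>i<s. K i \<in> cliques V E) \<and>
           (\<Sum>T \<in> cliques_of_size t V E. (1 - \<eta>) ^ card {i. i < s \<and> T \<subseteq> K i})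
             \<le> 2 ^ card V * (1 - \<eta> * (real t / real (card V)) ^ t) ^ s"
proof (induction s)
  case 0
  have "cliques_of_size t V E \<subseteq> Pow V" by (auto simp: cliques_of_size_def cliques_def)
  then have "card (cliques_of_size t V E) \<le> card (Pow V)" using V by (intro card_mono) auto
  then have "real (card (cliques_of_size t V E)) \<le> real (2 ^ card V)"
    using V by (simp only: card_Pow of_nat_le_iff)
  then show ?case by simp
next
  case (Suc s)
  let ?\<T> = "cliques_of_size t V E" and ?l = "(real t / real (card V)) ^ t"
  obtain K where K: "\<forall>i<s. K i \<in> cliques V E"
    and le: "(\<Sum>T \<in> ?\<T>. (1 - \<eta>) ^ card {i. i < s \<and> T \<subseteq> K i}) \<le> 2 ^ card V * (1 - \<eta> * ?l) ^ s"
    using Suc by blast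
  define w where "w T = (1 - \<eta>) ^ card {i. i < s \<and> T \<subseteq> K i}" for T
  obtain L where L: "L \<in> cliques V E" "(\<Sum>T | T \<in> ?\<T> \<and> T \<subseteq> L. w T) \<ge> ?l * (\<Sum>T \<in> ?\<T>. w T)"
    using heavy_clique[OF V t(1), of E w] \<eta> unfolding w_def by auto
  let ?K = "K(s := L)"
  have fin: "finite ?\<T>" using V by (intro finite_cliques_of_size)
  have card: "card {i. i < Suc s \<and> T \<subseteq> ?K i} = card {i. i < s \<and> T \<subseteq> K i} + of_bool (T \<subseteq> L)" for T
  proof -
    have "{i. i < Suc s \<and> T \<subseteq> ?K i} = (if T \<subseteq> L then {s} else {}) \<union> {i. i < s \<and> T \<subseteq> K i}"
      by (auto simp: less_Suc_eq)
    then show ?thesis by simp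
  qed
  have l1: "?l \<le> 1"
    using t V by (intro power_le_one) (auto simp: divide_le_eq_1)
  have "(\<Sum>T \<in> ?\<T>. (1 - \<eta>) ^ card {i. i < Suc s \<and> T \<subseteq> ?K i})
      = (\<Sum>T \<in> ?\<T>. w T - \<eta> * (if T \<subseteq> L then w T else 0))"
    unfolding card w_def by (intro sum.cong) (auto simp: algebra_simps)
  also have "\<dots> = (\<Sum>T \<in> ?\<T>. w T) - \<eta> * (\<Sum>T | T \<in> ?\<T> \<and> T \<subseteq> L. w T)"
    using fin by (simp add: sum_subtractf sum.inter_filter flip: sum_distrib_left)
  also have "\<dots> \<le> (\<Sum>T \<in> ?\<T>. w T) - \<eta> * (?l * (\<Sum>T \<in> ?\<T>. w T))"
    using L \<eta> by simp
  also have "\<dots> = (1 - \<eta> * ?l) * (\<Sum>T \<in> ?\<T>. w T)"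
    by (simp add: algebra_simps)
  also have "\<dots> \<le> (1 - \<eta> * ?l) * (2 ^ card V * (1 - \<eta> * ?l) ^ s)"
  proof (intro mult_left_mono)
    show "sum w ?\<T> \<le> 2 ^ card V * (1 - \<eta> * ?l) ^ s" using le unfolding w_def .
    have "\<eta> * ?l \<le> 1 * 1" using \<eta> l1 by (intro mult_mono) auto
    then show "0 \<le> 1 - \<eta> * ?l" by simp
  qed
  finally show ?case
    using K L by (intro exI[of _ ?K]) (auto simp: less_Suc_eq algebra_simps)
qed

text \<open>The cover is a list of \<open>s\<close> cliques, possibly repeated, each of weight
  \<open>1 / c\<close>. Both numbers are chosen before the graph, so that later all samples share
  one denominator and all hyperedges get the same weight.\<close>

lemma fractional_cover:
  assumes t: "t \<ge> 1" "t \<le> M" and \<epsilon>: "\<epsilon> > (0::real)"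
  shows "\<exists>s c. c \<ge> 1 \<and> real s \<le> (1 + \<epsilon>) * (real M / real t) ^ t * real c \<and>
     (\<forall>(V :: 'a set) E. finite V \<and> card V = M \<longrightarrow>
        (\<exists>K. (\<forall>i<s. K i \<in> cliques V E) \<and>
           (\<forall>T \<in> cliques_of_size t V E. c \<le> card {i. i < s \<and> T \<subseteq> K i})))"
proof -
  \<comment> \<open>Half of \<epsilon> pays for the factor \<open>1 - \<eta>\<close>; the other half
    is kept for the additive loss \<open>Q / \<eta>\<close>.\<close>
  define \<eta> where "\<eta> = \<epsilon> / (2 * (1 + \<epsilon>))"
  have \<eta>: "0 < \<eta>" "\<eta> < 1" and \<epsilon>\<eta>: "(1 + \<epsilon>) * (1 - \<eta>) = 1 + \<epsilon> / 2"
    using \<epsilon> by (auto simp: \<eta>_def field_simps)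
  define l where "l = (real t / real M) ^ t"
  have l: "l > 0" using t by (simp add: l_def)
  \<comment> \<open>The logarithm of the bound \<open>2 ^ M\<close> on the initial total
    weight.\<close>
  define Q where "Q = real M * ln 2"
  have Q: "Q \<ge> 0" by (simp add: Q_def)
  define a where "a = (1 + \<epsilon> / 2) * (Q / (\<eta> * l))"
  \<comment> \<open>Enough rounds for the additive loss \<open>a\<close>, which does not depend on
    \<open>s\<close>, to stay below \<open>s * \<epsilon> / 2\<close>.\<close>
  define s where "s = nat \<lceil>a * 2 / \<epsilon>\<rceil> + 1"
  have s: "real s > a * 2 / \<epsilon>"
    unfolding s_def by linarith
  \<comment> \<open>The coverage that \<open>s\<close> rounds guarantee: take logarithms in
    \<open>(1 - \<eta>) ^ m \<le> 2 ^ M * (1 - \<eta> * l) ^ s\<close> and use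
    \<open>- ln (1 - \<eta>) \<le> \<eta> / (1 - \<eta>)\<close> and
    \<open>ln (1 - \<eta> * l) \<le> - (\<eta> * l)\<close>.\<close>
  define R where "R = (1 - \<eta>) * (l * real s - Q / \<eta>)"
  have "a < real s * (\<epsilon> / 2)"
    using s \<epsilon> by (simp add: field_simps)
  then have "real s < (1 + \<epsilon> / 2) * (real s - Q / (\<eta> * l))"
    unfolding right_diff_distrib a_def[symmetric] by (simp add: algebra_simps)
  also have "\<dots> = (1 + \<epsilon>) / l * R"
    unfolding R_def \<epsilon>\<eta>[symmetric] using l \<eta> by (simp add: field_simps)
  finally have sR: "real s < (1 + \<epsilon>) / l * R" .
  have "0 < real s" by (simp add: s_def)
  then have "0 < (1 + \<epsilon>) / l * R" using sR by linarith
  then have R0: "R > 0" using l \<epsilon> by (simp add: zero_less_mult_iff zero_less_divide_iff)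
  define c where "c = nat \<lceil>R\<rceil>"
  have c1: "c \<ge> 1" and cR: "real c \<ge> R" using R0 by (auto simp: c_def) linarith
  have "real s \<le> (1 + \<epsilon>) / l * real c"
    using sR mult_left_mono[OF cR, of "(1 + \<epsilon>) / l"] l \<epsilon> by simp
  also have "\<dots> = (1 + \<epsilon>) * (real M / real t) ^ t * real c"
    using t by (simp add: l_def power_divide)
  finally have sc: "real s \<le> (1 + \<epsilon>) * (real M / real t) ^ t * real c" .
  have "\<exists>K. (\<forall>i<s. K i \<in> cliques V E) \<and>
           (\<forall>T \<in> cliques_of_size t V E. c \<le> card {i. i < s \<and> T \<subseteq> K i})"
    if V: "finite V" "card V = M" for V :: "'a set" and E
  proof -
    have "V \<noteq> {}" using V t by auto
    then obtain K where K: "\<forall>i<s. K i \<in> cliques V E"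
      and sum: "(\<Sum>T \<in> cliques_of_size t V E. (1 - \<eta>) ^ card {i. i < s \<and> T \<subseteq> K i})
             \<le> 2 ^ M * (1 - \<eta> * l) ^ s"
      using multiplicative_weights[OF V(1) _ t(1) _ \<eta>, of s E] V t unfolding l_def by auto
    have "c \<le> card {i. i < s \<and> T \<subseteq> K i}" if T: "T \<in> cliques_of_size t V E" for T
    proof -
      let ?c = "card {i. i < s \<and> T \<subseteq> K i}"
      have l1: "l \<le> 1"
        using t unfolding l_def by (intro power_le_one) (auto simp: divide_le_eq_1)
      have "\<eta> * l < 1 * 1" using \<eta> l l1 by (intro mult_less_le_imp_less) auto
      then have pos: "0 < 1 - \<eta> * l" by simp
      have "(1 - \<eta>) ^ ?c \<le> (\<Sum>T \<in> cliques_of_size t V E. (1 - \<eta>) ^ card {i. i < s \<and> T \<subseteq> K i})"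
        using \<eta> T finite_cliques_of_size[OF V(1)] by (intro member_le_sum) auto
      also note sum
      finally have "ln ((1 - \<eta>) ^ ?c) \<le> ln (2 ^ M * (1 - \<eta> * l) ^ s)"
        using \<eta> pos by (subst ln_le_cancel_iff) auto
      then have "real ?c * ln (1 - \<eta>) \<le> Q + real s * ln (1 - \<eta> * l)"
        using \<eta> pos by (simp add: ln_mult ln_realpow Q_def)
      also have "ln (1 - \<eta> * l) \<le> - (\<eta> * l)"
        using ln_le_minus_one[OF pos] by simp
      finally have 1: "real ?c * ln (1 - \<eta>) \<le> Q - real s * (\<eta> * l)"
        by (simp add: mult_left_mono)
      have "ln (1 / (1 - \<eta>)) \<le> 1 / (1 - \<eta>) - 1"
        using \<eta> by (intro ln_le_minus_one) auto
      then have "- ln (1 - \<eta>) \<le> \<eta> / (1 - \<eta>)"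
        using \<eta> by (simp add: ln_div field_simps)
      then have "real ?c * (- ln (1 - \<eta>)) \<le> real ?c * (\<eta> / (1 - \<eta>))"
        by (intro mult_left_mono) auto
      then have "real s * (\<eta> * l) - Q \<le> real ?c * (\<eta> / (1 - \<eta>))"
        using 1 by simp
      then have "R \<le> real ?c"
        using \<eta> unfolding R_def by (simp add: field_simps)
      then show ?thesis unfolding c_def by linarith
    qed
    then show ?thesis using K by blast
  qed
  then show ?thesis using c1 sc by blast
qed

subsection \<open>Random subsets\<close>

text \<open>The probability of the outcome \<open>J\<close> when every \<open>i\<close> is selected
  independently with probability \<open>q i\<close>. Expectations are then finite sums over
  \<open>Pow I\<close>.\<close>

definition subset_mass :: "'i set \<Rightarrow> ('i \<Rightarrow> real) \<Rightarrow> 'i set \<Rightarrow> real" where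
  "subset_mass I q J = (\<Prod>i\<in>J. q i) * (\<Prod>i\<in>I - J. 1 - q i)"

text \<open>Expanding the product of \<open>q i * of_bool (i \<notin> A) + (1 - q i)\<close> over
  \<open>I\<close> yields one term per outcome \<open>J\<close>, and the factor of each
  \<open>i\<close> in \<open>A\<close> is \<open>1 - q i\<close>. All moments below reduce to such
  avoidance probabilities.\<close>

lemma subset_mass_avoid:
  assumes "finite I" "A \<subseteq> I"
  shows "(\<Sum>J\<in>Pow I. subset_mass I q J * of_bool (J \<inter> A = {})) = (\<Prod>i\<in>A. 1 - q i)"
proof -
  have "(\<Sum>J\<in>Pow I. subset_mass I q J * of_bool (J \<inter> A = {}))
      = (\<Sum>J\<in>Pow I. (\<Prod>i\<in>J. q i * of_bool (i \<notin> A)) * (\<Prod>i\<in>I - J. 1 - q i))"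
  proof (rule sum.cong[OF refl])
    fix J assume "J \<in> Pow I"
    then have "finite J" using assms finite_subset by blast
    then have "(\<Prod>i\<in>J. q i * of_bool (i \<notin> A)) = (\<Prod>i\<in>J. q i) * of_bool (J \<inter> A = {})"
      by induction auto
    then show "subset_mass I q J * of_bool (J \<inter> A = {})
        = (\<Prod>i\<in>J. q i * of_bool (i \<notin> A)) * (\<Prod>i\<in>I - J. 1 - q i)"
      by (simp add: subset_mass_def)
  qed
  also have "\<dots> = (\<Prod>i\<in>I. q i * of_bool (i \<notin> A) + (1 - q i))"
    by (rule prod_add[OF assms(1), symmetric])
  also have "\<dots> = (\<Prod>i\<in>I. if i \<in> A then 1 - q i else 1)"
    by (intro prod.cong) auto
  also have "\<dots> = (\<Prod>i\<in>A. 1 - q i)"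
    using assms by (simp add: prod.If_cases Int_absorb1)
  finally show ?thesis .
qed

lemma subset_mass_total: "finite I \<Longrightarrow> (\<Sum>J\<in>Pow I. subset_mass I q J) = 1"
  using subset_mass_avoid[of I "{}" q] by simp

lemma subset_mass_card:
  assumes "finite I"
  shows "(\<Sum>J\<in>Pow I. subset_mass I q J * real (card J)) = (\<Sum>i\<in>I. q i)"
proof -
  have "(\<Sum>J\<in>Pow I. subset_mass I q J * real (card J))
      = (\<Sum>J\<in>Pow I. \<Sum>i\<in>I. subset_mass I q J * (1 - of_bool (J \<inter> {i} = {})))"
  proof (rule sum.cong[OF refl])
    fix J assume "J \<in> Pow I"
    then have "real (card J) = (\<Sum>i\<in>I. of_bool (i \<in> J))"
      using assms by (simp add: of_bool_def sum.If_cases Int_absorb1)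
    also have "\<dots> = (\<Sum>i\<in>I. 1 - of_bool (J \<inter> {i} = {}))"
      by (intro sum.cong) auto
    finally show "subset_mass I q J * real (card J)
        = (\<Sum>i\<in>I. subset_mass I q J * (1 - of_bool (J \<inter> {i} = {})))"
      by (simp add: sum_distrib_left)
  qed
  also have "\<dots> = (\<Sum>i\<in>I. \<Sum>J\<in>Pow I. subset_mass I q J - subset_mass I q J * of_bool (J \<inter> {i} = {}))"
    unfolding right_diff_distrib mult_1_right by (rule sum.swap)
  also have "\<dots> = (\<Sum>i\<in>I. q i)"
  proof (rule sum.cong[OF refl])
    fix i assume "i \<in> I"
    then have "(\<Sum>J\<in>Pow I. subset_mass I q J * of_bool (J \<inter> {i} = {})) = 1 - q i"
      using subset_mass_avoid[OF assms, of "{i}" q] by simp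
    then show "(\<Sum>J\<in>Pow I. subset_mass I q J - subset_mass I q J * of_bool (J \<inter> {i} = {})) = q i"
      unfolding sum_subtractf subset_mass_total[OF assms] by simp
  qed
  finally show ?thesis .
qed

lemma subset_mass_nonneg:
  assumes "\<And>i. i \<in> I \<Longrightarrow> 0 \<le> q i \<and> q i \<le> 1" "J \<subseteq> I"
  shows "subset_mass I q J \<ge> 0"
  unfolding subset_mass_def using assms by (intro mult_nonneg_nonneg prod_nonneg) auto

lemma exists_le_expectation:
  assumes "finite I" "\<And>i. i \<in> I \<Longrightarrow> 0 \<le> q i \<and> q i \<le> 1"
  shows "\<exists>J\<subseteq>I. X J \<le> (\<Sum>J\<in>Pow I. subset_mass I q J * X J)"
proof (rule ccontr)
  define m where "m = (\<Sum>J\<in>Pow I. subset_mass I q J * X J)"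
  assume "\<not> ?thesis"
  then have less: "X J > m" if "J \<subseteq> I" for J
    unfolding m_def using that by (meson not_le)
  have tot: "(\<Sum>J\<in>Pow I. subset_mass I q J) = 1" using subset_mass_total[OF assms(1)] .
  have nn: "subset_mass I q J \<ge> 0" if "J \<in> Pow I" for J
    using that assms(2) by (simp add: subset_mass_nonneg)
  obtain K where K: "K \<in> Pow I" "subset_mass I q K > 0"
  proof (rule ccontr)
    assume "\<not> thesis"
    then have "subset_mass I q J \<le> 0" if "J \<in> Pow I" for J
      using that(1) \<open>\<And>K. K \<in> Pow I \<Longrightarrow> 0 < subset_mass I q K \<Longrightarrow> thesis\<close> not_le by blast
    then have "(\<Sum>J\<in>Pow I. subset_mass I q J) \<le> 0" by (rule sum_nonpos)
    then show False using tot by simp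
  qed
  have "(\<Sum>J\<in>Pow I. subset_mass I q J * m) < (\<Sum>J\<in>Pow I. subset_mass I q J * X J)"
  proof (rule sum_strict_mono_ex1)
    show "finite (Pow I)" using assms(1) by simp
    show "\<forall>J\<in>Pow I. subset_mass I q J * m \<le> subset_mass I q J * X J"
      using less nn by (simp add: less_imp_le mult_left_mono)
    show "\<exists>J\<in>Pow I. subset_mass I q J * m < subset_mass I q J * X J"
      using K less by (intro bexI[of _ K]) simp_all
  qed
  then show False
    unfolding sum_distrib_right[symmetric] tot m_def[symmetric] by simp
qed

lemma sum_mult_of_bool:
  fixes w :: "'i \<Rightarrow> real"
  assumes "finite I"
  shows "(\<Sum>i\<in>I. w i * of_bool (P i)) = (\<Sum>i | i \<in> I \<and> P i. w i)"
  unfolding sum.inter_filter[OF assms] by (rule sum.cong) auto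

subsection \<open>The nibble for weighted hypergraphs\<close>

text \<open>The hyperedges are indexed, so that repetitions are allowed.\<close>

definition wdegree :: "'i set \<Rightarrow> ('i \<Rightarrow> 'x set) \<Rightarrow> ('i \<Rightarrow> real) \<Rightarrow> 'x \<Rightarrow> real" where
  "wdegree I E w T = (\<Sum>i | i \<in> I \<and> T \<in> E i. w i)"

text \<open>\<open>B\<close> is only a crude ceiling, allowed to grow from round to round and
  entering nothing but constants; how close the degrees are to 1 is measured separately. The
  smallness of \<delta> is what makes different points nearly independent.\<close>

locale weighted_hypergraph =
  fixes U :: "'x set" and I :: "'i set" and E :: "'i \<Rightarrow> 'x set" and w :: "'i \<Rightarrow> real"
    and r :: nat and B \<delta> :: real
  assumes delta_nonneg: "\<delta> \<ge> 0" and finU: "finite U" and finI: "finite I"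
    and sub: "i \<in> I \<Longrightarrow> E i \<subseteq> U" and nonempty: "i \<in> I \<Longrightarrow> E i \<noteq> {}" and card_le: "i \<in> I \<Longrightarrow> card (E i) \<le> r"
    and w_nonneg: "i \<in> I \<Longrightarrow> w i \<ge> 0"
    and degree_le: "T \<in> U \<Longrightarrow> wdegree I E w T \<le> B"
    and codegree_le: "T \<in> U \<Longrightarrow> T' \<in> U \<Longrightarrow> T \<noteq> T' \<Longrightarrow> (\<Sum>i | i \<in> I \<and> T \<in> E i \<and> T' \<in> E i. w i) \<le> \<delta>"
begin

section \<open>The weight of the hyperedges meeting a point set\<close>

definition touch :: "'x set \<Rightarrow> real" where
  "touch A = (\<Sum>i | i \<in> I \<and> E i \<inter> A \<noteq> {}. w i)"

lemma finE: "i \<in> I \<Longrightarrow> finite (E i)"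
  using sub finU finite_subset by blast

lemma sum_wdegree:
  assumes "A \<subseteq> U"
  shows "(\<Sum>T\<in>A. wdegree I E w T * z T) = (\<Sum>i\<in>I. w i * (\<Sum>T\<in>E i \<inter> A. z T))"
proof -
  have "finite A" using assms finU finite_subset by blast
  have "(\<Sum>T\<in>A. wdegree I E w T * z T) = (\<Sum>T\<in>A. \<Sum>i\<in>I. if T \<in> E i then w i * z T else 0)"
    unfolding wdegree_def sum_distrib_right by (simp add: sum.inter_filter[OF finI])
  also have "\<dots> = (\<Sum>i\<in>I. \<Sum>T\<in>A. if T \<in> E i then w i * z T else 0)"
    by (rule sum.swap)
  also have "\<dots> = (\<Sum>i\<in>I. w i * (\<Sum>T\<in>E i \<inter> A. z T))"
    by (intro sum.cong refl) (simp add: sum_distrib_left Int_commute[of _ A] sum.inter_restrict[OF \<open>finite A\<close>]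
        if_distrib cong: if_cong)
  finally show ?thesis .
qed

lemma touch_le:
  assumes "A \<subseteq> U"
  shows "touch A \<le> (\<Sum>T\<in>A. wdegree I E w T)"
proof -
  have finA: "finite A" using assms finU finite_subset by blast
  have "touch A = (\<Sum>i\<in>I. w i * of_bool (E i \<inter> A \<noteq> {}))"
    unfolding touch_def sum_mult_of_bool[OF finI] ..
  also have "\<dots> \<le> (\<Sum>i\<in>I. w i * (\<Sum>T\<in>E i \<inter> A. 1))"
    using w_nonneg finA by (intro sum_mono mult_left_mono) (auto simp: Suc_le_eq card_gt_0_iff)
  also have "\<dots> = (\<Sum>T\<in>A. wdegree I E w T)"
    using sum_wdegree[OF assms, of "\<lambda>_. 1"] by simp
  finally show ?thesis .
qed

lemma touch_singleton: "touch {T} = wdegree I E w T"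
  by (simp add: touch_def wdegree_def Int_def)

text \<open>Bonferroni: the degree sum counts a hyperedge with \<open>m\<close> points in
  \<open>A\<close> exactly \<open>m - 1\<close> times too often. Fixing one of these points, its
  pairs with the others are \<open>m - 1\<close> of the ordered pairs inside the hyperedge, and each
  pair of points carries weight at most \<delta>.\<close>

lemma touch_ge:
  assumes "A \<subseteq> U"
  shows "touch A \<ge> (\<Sum>T\<in>A. wdegree I E w T) - real (card A) ^ 2 * \<delta>"
proof -
  have finA: "finite A" using assms finU finite_subset by blast
  let ?P = "{p \<in> A \<times> A. fst p \<noteq> snd p}"
  have finP: "finite ?P" using finA by simp
  have *: "real (card (E i \<inter> A)) \<le> of_bool (E i \<inter> A \<noteq> {}) + (\<Sum>p\<in>?P. of_bool (fst p \<in> E i \<and> snd p \<in> E i))"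
    for i
  proof (cases "E i \<inter> A = {}")
    case False
    then obtain T0 where T0: "T0 \<in> E i" "T0 \<in> A" by auto
    have "card (E i \<inter> A) = Suc (card (E i \<inter> A - {T0}))"
      using T0 finA by (subst card.remove[of _ T0]) auto
    also have "card (E i \<inter> A - {T0}) = card ((\<lambda>T. (T0, T)) ` (E i \<inter> A - {T0}))"
      by (intro card_image[symmetric]) (auto simp: inj_on_def)
    also have "\<dots> \<le> card {p\<in>?P. fst p \<in> E i \<and> snd p \<in> E i}"
    proof (rule card_mono)
      show "finite {p\<in>?P. fst p \<in> E i \<and> snd p \<in> E i}"
        by (rule finite_subset[OF _ finP]) auto
    qed (use T0 in auto)
    finally have "real (card (E i \<inter> A)) \<le> 1 + real (card {p\<in>?P. fst p \<in> E i \<and> snd p \<in> E i})"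
      by simp
    also have "\<dots> = 1 + (\<Sum>p\<in>?P. of_bool (fst p \<in> E i \<and> snd p \<in> E i))"
      using sum_mult_of_bool[OF finP, of "\<lambda>_. 1" "\<lambda>p. fst p \<in> E i \<and> snd p \<in> E i"] by simp
    finally show ?thesis using False by simp
  qed (simp add: sum_nonneg)
  have "(\<Sum>T\<in>A. wdegree I E w T) = (\<Sum>i\<in>I. w i * real (card (E i \<inter> A)))"
    using sum_wdegree[OF assms, of "\<lambda>_. 1"] by simp
  also have "\<dots> \<le> (\<Sum>i\<in>I. w i * (of_bool (E i \<inter> A \<noteq> {}) + (\<Sum>p\<in>?P. of_bool (fst p \<in> E i \<and> snd p \<in> E i))))"
    using w_nonneg * by (intro sum_mono mult_left_mono) auto
  also have "\<dots> = (\<Sum>i\<in>I. w i * of_bool (E i \<inter> A \<noteq> {}))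
      + (\<Sum>i\<in>I. \<Sum>p\<in>?P. w i * of_bool (fst p \<in> E i \<and> snd p \<in> E i))"
    unfolding distrib_left sum.distrib sum_distrib_left ..
  also have "(\<Sum>i\<in>I. w i * of_bool (E i \<inter> A \<noteq> {})) = touch A"
    unfolding touch_def sum_mult_of_bool[OF finI] ..
  also have "(\<Sum>i\<in>I. \<Sum>p\<in>?P. w i * of_bool (fst p \<in> E i \<and> snd p \<in> E i))
      = (\<Sum>p\<in>?P. \<Sum>i\<in>I. w i * of_bool (fst p \<in> E i \<and> snd p \<in> E i))"
    by (rule sum.swap)
  also have "\<dots> \<le> (\<Sum>p\<in>?P. \<delta>)"
  proof (rule sum_mono)
    fix p assume "p \<in> ?P"
    then have "(\<Sum>i | i \<in> I \<and> fst p \<in> E i \<and> snd p \<in> E i. w i) \<le> \<delta>"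
      using assms by (intro codegree_le) auto
    also have "(\<Sum>i | i \<in> I \<and> fst p \<in> E i \<and> snd p \<in> E i. w i)
        = (\<Sum>i\<in>I. w i * of_bool (fst p \<in> E i \<and> snd p \<in> E i))"
      by (rule sum_mult_of_bool[OF finI, symmetric])
    finally show "(\<Sum>i\<in>I. w i * of_bool (fst p \<in> E i \<and> snd p \<in> E i)) \<le> \<delta>" .
  qed
  also have "(\<Sum>p\<in>?P. \<delta>) \<le> real (card A) ^ 2 * \<delta>"
  proof -
    have "card ?P \<le> card (A \<times> A)" using finA by (intro card_mono) auto
    also have "\<dots> = card A ^ 2" by (simp add: card_cartesian_product power2_eq_square)
    finally have "real (card ?P) \<le> real (card A) ^ 2"
      unfolding of_nat_power[symmetric] of_nat_le_iff .
    then show ?thesis using delta_nonneg by (simp add: mult_right_mono)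
  qed
  finally show ?thesis by simp
qed

section \<open>The random selection of one round and its exact moments\<close>

definition left :: "'i set \<Rightarrow> 'x set" where
  "left J = U - (\<Union>i\<in>J. E i)"

text \<open>Partly covered hyperedges are dropped rather than shortened; \<open>new_weight\<close>
  compensates for the degree lost this way.\<close>

definition kept :: "'i set \<Rightarrow> 'i set" where
  "kept J = {i \<in> I. E i \<subseteq> left J}"

text \<open>Hyperedge \<open>i\<close> is selected with probability \<open>1 - exp (- \<eta> * w i)\<close>, which makes survival
  probabilities exact exponentials.\<close>

definition expect :: "real \<Rightarrow> ('i set \<Rightarrow> real) \<Rightarrow> real" where
  "expect \<eta> X = (\<Sum>J\<in>Pow I. subset_mass I (\<lambda>i. 1 - exp (- \<eta> * w i)) J * X J)"

lemma expect_add: "expect \<eta> (\<lambda>J. X J + Y J) = expect \<eta> X + expect \<eta> Y"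
  by (simp add: expect_def distrib_left sum.distrib)

lemma expect_diff: "expect \<eta> (\<lambda>J. X J - Y J) = expect \<eta> X - expect \<eta> Y"
  by (simp add: expect_def right_diff_distrib sum_subtractf)

lemma expect_cmult: "expect \<eta> (\<lambda>J. c * X J) = c * expect \<eta> X"
  by (simp add: expect_def sum_distrib_left mult_ac)

lemma expect_sum: "expect \<eta> (\<lambda>J. \<Sum>z\<in>Z. X z J) = (\<Sum>z\<in>Z. expect \<eta> (X z))"
  unfolding expect_def sum_distrib_left by (rule sum.swap)

lemma expect_cong: "(\<And>J. J \<subseteq> I \<Longrightarrow> X J = Y J) \<Longrightarrow> expect \<eta> X = expect \<eta> Y"
  unfolding expect_def by (intro sum.cong) auto

lemma expect_left:
  assumes "A \<subseteq> U"
  shows "expect \<eta> (\<lambda>J. of_bool (A \<subseteq> left J)) = exp (- \<eta> * touch A)"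
proof -
  let ?A = "{i \<in> I. E i \<inter> A \<noteq> {}}"
  have "expect \<eta> (\<lambda>J. of_bool (A \<subseteq> left J)) = expect \<eta> (\<lambda>J. of_bool (J \<inter> ?A = {}))"
    using assms by (intro expect_cong arg_cong[where f = of_bool]) (auto simp: left_def)
  also have "\<dots> = (\<Prod>i\<in>?A. exp (- \<eta> * w i))"
    unfolding expect_def using finI by (subst subset_mass_avoid) auto
  also have "\<dots> = exp (- \<eta> * touch A)"
    using finI by (simp add: touch_def sum_distrib_left sum_negf flip: exp_sum)
  finally show ?thesis .
qed

lemma expect_card_le:
  shows "expect \<eta> (\<lambda>J. real (card J)) \<le> \<eta> * (\<Sum>i\<in>I. w i)"
proof -
  have "expect \<eta> (\<lambda>J. real (card J)) = (\<Sum>i\<in>I. 1 - exp (- \<eta> * w i))"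
    unfolding expect_def by (rule subset_mass_card[OF finI])
  also have "\<dots> \<le> (\<Sum>i\<in>I. \<eta> * w i)"
    by (intro sum_mono) (use exp_ge_add_one_self[of "- \<eta> * w _"] in \<open>simp add: algebra_simps\<close>)
  finally show ?thesis by (simp add: sum_distrib_left)
qed

lemma exists_le_expect:
  assumes "\<eta> \<ge> 0"
  shows "\<exists>J\<subseteq>I. X J \<le> expect \<eta> X"
  unfolding expect_def using finI w_nonneg assms by (intro exists_le_expectation) auto

text \<open>The factor compensates for the probability of about \<open>exp (- \<eta> * (card (E i) - 1))\<close> that the other
  points of \<open>E i\<close> stay uncovered, which keeps the degrees close to 1 also for hyperedges of different
  sizes.\<close>

definition new_weight :: "real \<Rightarrow> 'i \<Rightarrow> real" where
  "new_weight \<eta> i = w i * exp (\<eta> * (real (card (E i)) - 1))"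

definition deficit :: "'x \<Rightarrow> real" where
  "deficit T = 1 - wdegree I E w T"

definition total_deficit :: real where
  "total_deficit = (\<Sum>T\<in>U. \<bar>deficit T\<bar>)"

lemma expect_card_left:
  "expect \<eta> (\<lambda>J. real (card (left J))) = (\<Sum>T\<in>U. exp (- \<eta> * wdegree I E w T))"
proof -
  have "expect \<eta> (\<lambda>J. real (card (left J))) = expect \<eta> (\<lambda>J. \<Sum>T\<in>U. of_bool ({T} \<subseteq> left J))"
  proof (rule expect_cong)
    fix J
    have "left J \<subseteq> U" by (auto simp: left_def)
    then show "real (card (left J)) = (\<Sum>T\<in>U. of_bool ({T} \<subseteq> left J))"
      using finU by (simp add: of_bool_def sum.If_cases Int_absorb1)
  qed
  also have "\<dots> = (\<Sum>T\<in>U. exp (- \<eta> * wdegree I E w T))"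
    unfolding expect_sum
  proof (rule sum.cong[OF refl])
    fix T assume "T \<in> U"
    then show "expect \<eta> (\<lambda>J. of_bool ({T} \<subseteq> left J)) = exp (- \<eta> * wdegree I E w T)"
      unfolding touch_singleton[symmetric] by (intro expect_left) auto
  qed
  finally show ?thesis .
qed

lemma expect_kept:
  "expect \<eta> (\<lambda>J. \<Sum>i\<in>kept J. new_weight \<eta> i) = (\<Sum>i\<in>I. new_weight \<eta> i * exp (- \<eta> * touch (E i)))"
proof -
  have "expect \<eta> (\<lambda>J. \<Sum>i\<in>kept J. new_weight \<eta> i)
      = expect \<eta> (\<lambda>J. \<Sum>i\<in>I. new_weight \<eta> i * of_bool (E i \<subseteq> left J))"
    unfolding kept_def sum_mult_of_bool[OF finI] ..
  also have "\<dots> = (\<Sum>i\<in>I. new_weight \<eta> i * exp (- \<eta> * touch (E i)))"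
    unfolding expect_sum by (intro sum.cong refl) (simp add: expect_cmult expect_left sub)
  finally show ?thesis .
qed

text \<open>A hyperedge through \<open>T\<close> can be kept only if \<open>T\<close> is left, so
  the indicator of \<open>T\<close> is absorbed when the square is expanded. Two hyperedges are both
  kept exactly when their union stays uncovered, which turns the second moment into avoidance
  probabilities as well.\<close>

lemma expect_defect:
  "expect \<eta> (\<lambda>J. \<Sum>T\<in>left J. (1 - wdegree (kept J) E (new_weight \<eta>) T)\<^sup>2)
   = (\<Sum>T\<in>U. exp (- \<eta> * wdegree I E w T)
        - 2 * (\<Sum>i | i \<in> I \<and> T \<in> E i. new_weight \<eta> i * exp (- \<eta> * touch (E i)))
        + (\<Sum>i | i \<in> I \<and> T \<in> E i. \<Sum>j | j \<in> I \<and> T \<in> E j.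
             new_weight \<eta> i * new_weight \<eta> j * exp (- \<eta> * touch (E i \<union> E j))))"
proof -
  let ?w = "new_weight \<eta>"
  let ?I = "\<lambda>T. {i \<in> I. T \<in> E i}"
  let ?f = "\<lambda>T J. of_bool ({T} \<subseteq> left J) - 2 * (\<Sum>i\<in>?I T. ?w i * of_bool (E i \<subseteq> left J))
     + (\<Sum>i\<in>?I T. \<Sum>j\<in>?I T. ?w i * ?w j * of_bool (E i \<union> E j \<subseteq> left J))"
  have "expect \<eta> (\<lambda>J. \<Sum>T\<in>left J. (1 - wdegree (kept J) E ?w T)\<^sup>2) = expect \<eta> (\<lambda>J. \<Sum>T\<in>U. ?f T J)"
  proof (rule expect_cong)
    fix J
    have f: "?f T J = (if T \<in> left J then (1 - wdegree (kept J) E ?w T)\<^sup>2 else 0)" for T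
    proof -
      let ?s = "\<Sum>i\<in>?I T. ?w i * of_bool (E i \<subseteq> left J)"
      have "(\<Sum>i\<in>?I T. \<Sum>j\<in>?I T. ?w i * ?w j * of_bool (E i \<union> E j \<subseteq> left J)) = ?s * ?s"
        unfolding sum_product by (intro sum.cong refl) (auto simp: of_bool_def)
      then have *: "?f T J = of_bool (T \<in> left J) - 2 * ?s + ?s * ?s" by simp
      have s: "?s = wdegree (kept J) E ?w T"
        unfolding wdegree_def kept_def using finI
        by (subst sum_mult_of_bool) (auto intro!: sum.cong)
      show ?thesis
      proof (cases "T \<in> left J")
        case True
        then show ?thesis unfolding * unfolding s by (simp add: power2_eq_square algebra_simps)
      next
        case False
        then have "?s = 0" by (intro sum.neutral) auto
        then show ?thesis unfolding * using False by simp
      qed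
    qed
    have "left J \<subseteq> U" by (auto simp: left_def)
    then show "(\<Sum>T\<in>left J. (1 - wdegree (kept J) E ?w T)\<^sup>2) = (\<Sum>T\<in>U. ?f T J)"
      unfolding f using finU by (simp add: sum.If_cases Int_absorb1)
  qed
  also have "\<dots> = (\<Sum>T\<in>U. exp (- \<eta> * touch {T})
        - 2 * (\<Sum>i\<in>?I T. ?w i * exp (- \<eta> * touch (E i)))
        + (\<Sum>i\<in>?I T. \<Sum>j\<in>?I T. ?w i * ?w j * exp (- \<eta> * touch (E i \<union> E j))))"
    unfolding expect_sum expect_add expect_diff expect_cmult
  proof (rule sum.cong[OF refl])
    fix T assume "T \<in> U"
    then have 1: "expect \<eta> (\<lambda>J. of_bool ({T} \<subseteq> left J)) = exp (- \<eta> * touch {T})"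
      by (intro expect_left) auto
    have 2: "(\<Sum>i\<in>?I T. ?w i * expect \<eta> (\<lambda>J. of_bool (E i \<subseteq> left J)))
        = (\<Sum>i\<in>?I T. ?w i * exp (- \<eta> * touch (E i)))"
      using sub by (intro sum.cong refl) (simp add: expect_left)
    have 3: "(\<Sum>i\<in>?I T. \<Sum>j\<in>?I T. ?w i * ?w j * expect \<eta> (\<lambda>J. of_bool (E i \<union> E j \<subseteq> left J)))
        = (\<Sum>i\<in>?I T. \<Sum>j\<in>?I T. ?w i * ?w j * exp (- \<eta> * touch (E i \<union> E j)))"
    proof (intro sum.cong refl)
      fix i j assume "i \<in> ?I T" "j \<in> ?I T"
      then have "expect \<eta> (\<lambda>J. of_bool (E i \<union> E j \<subseteq> left J)) = exp (- \<eta> * touch (E i \<union> E j))"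
        using sub by (intro expect_left) auto
      then show "?w i * ?w j * expect \<eta> (\<lambda>J. of_bool (E i \<union> E j \<subseteq> left J))
          = ?w i * ?w j * exp (- \<eta> * touch (E i \<union> E j))" by (rule arg_cong)
    qed
    show "expect \<eta> (\<lambda>J. of_bool ({T} \<subseteq> left J))
        - 2 * (\<Sum>i\<in>?I T. ?w i * expect \<eta> (\<lambda>J. of_bool (E i \<subseteq> left J)))
        + (\<Sum>i\<in>?I T. \<Sum>j\<in>?I T. ?w i * ?w j * expect \<eta> (\<lambda>J. of_bool (E i \<union> E j \<subseteq> left J)))
      = exp (- \<eta> * touch {T}) - 2 * (\<Sum>i\<in>?I T. ?w i * exp (- \<eta> * touch (E i)))
        + (\<Sum>i\<in>?I T. \<Sum>j\<in>?I T. ?w i * ?w j * exp (- \<eta> * touch (E i \<union> E j)))"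
      unfolding 1 2 3 ..
  qed
  finally show ?thesis unfolding touch_singleton .
qed

end

section \<open>Moment estimates for one round\<close>

lemma abs_exp_minus_one_le:
  fixes y :: real
  assumes "\<bar>y\<bar> \<le> Y"
  shows "\<bar>exp y - 1\<bar> \<le> exp Y * \<bar>y\<bar>"
proof (cases "y \<ge> 0")
  case True
  have "1 = exp y * exp (- y)" by (simp flip: exp_add)
  also have "\<dots> \<ge> exp y * (1 - y)"
    using exp_ge_add_one_self[of "- y"] by (intro mult_left_mono) auto
  finally have "exp y - 1 \<le> exp y * y" by (simp add: algebra_simps)
  also have "\<dots> \<le> exp Y * y" using True assms by (intro mult_right_mono) auto
  finally show ?thesis using True by simp
next
  case False
  have "exp y \<le> 1" using False by simp
  then have "\<bar>exp y - 1\<bar> \<le> 1 * \<bar>y\<bar>" using False exp_ge_add_one_self[of y] by linarith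
  also have "\<dots> \<le> exp Y * \<bar>y\<bar>" using assms by (intro mult_right_mono) auto
  finally show ?thesis .
qed

text \<open>One Lipschitz constant for every exponent linearised below: single deficits are at most
  \<open>B\<close>, deficit sums over a hyperedge at most \<open>r * B\<close>, and overlap errors
  at most \<open>4 * r ^ 2\<close> because \<delta> is at most 1.\<close>

definition exp_bound :: "nat \<Rightarrow> real \<Rightarrow> real" where
  "exp_bound r B = exp ((real r + 1) * B + 4 * real r ^ 2)"

lemma exp_bound_ge_one: "B \<ge> 0 \<Longrightarrow> exp_bound r B \<ge> 1"
  by (simp add: exp_bound_def)

lemma exp_le_exp_bound:
  assumes "\<bar>y\<bar> \<le> (real r + 1) * B + 4 * real r ^ 2"
  shows "\<bar>exp y - 1\<bar> \<le> exp_bound r B * \<bar>y\<bar>" "exp y \<le> 1 + exp_bound r B * \<bar>y\<bar>" "exp y \<le> exp_bound r B"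
proof -
  show *: "\<bar>exp y - 1\<bar> \<le> exp_bound r B * \<bar>y\<bar>"
    unfolding exp_bound_def using assms by (rule abs_exp_minus_one_le)
  show "exp y \<le> 1 + exp_bound r B * \<bar>y\<bar>" using * by linarith
  show "exp y \<le> exp_bound r B" unfolding exp_bound_def using assms by simp
qed

context weighted_hypergraph
begin

lemma wdegree_nonneg: "wdegree I E w T \<ge> 0"
  unfolding wdegree_def using w_nonneg by (intro sum_nonneg) auto

lemma abs_deficit_le:
  assumes "T \<in> U" "B \<ge> 1"
  shows "\<bar>deficit T\<bar> \<le> B"
  using wdegree_nonneg[of T] degree_le[OF assms(1)] assms(2) unfolding deficit_def by linarith

lemma sum_wdegree_eq: "(\<Sum>T\<in>A. wdegree I E w T) = real (card A) - (\<Sum>T\<in>A. deficit T)"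
  by (simp add: deficit_def sum_subtractf)

lemma sum_abs_deficit_le:
  assumes "A \<subseteq> U" "B \<ge> 1"
  shows "(\<Sum>T\<in>A. \<bar>deficit T\<bar>) \<le> real (card A) * B"
  using sum_bounded_above[of A "\<lambda>T. \<bar>deficit T\<bar>" B] abs_deficit_le[OF _ assms(2)] assms(1) by blast

lemma sum_edges_le:
  assumes "\<And>T. T \<in> U \<Longrightarrow> z T \<ge> 0"
  shows "(\<Sum>i\<in>I. w i * (\<Sum>T\<in>E i. z T)) \<le> B * (\<Sum>T\<in>U. z T)"
proof -
  have "(\<Sum>i\<in>I. w i * (\<Sum>T\<in>E i. z T)) = (\<Sum>T\<in>U. wdegree I E w T * z T)"
    using sub by (subst sum_wdegree) (auto simp: Int_absorb2 intro!: sum.cong)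
  also have "\<dots> \<le> (\<Sum>T\<in>U. B * z T)"
    using degree_le assms by (intro sum_mono mult_right_mono) auto
  finally show ?thesis by (simp add: sum_distrib_left)
qed

lemma sum_weights_le: "(\<Sum>i\<in>I. w i) \<le> B * real (card U)"
proof -
  have "(\<Sum>i\<in>I. w i) \<le> (\<Sum>i\<in>I. w i * (\<Sum>T\<in>E i. 1))"
  proof (rule sum_mono)
    fix i assume i: "i \<in> I"
    have "1 \<le> real (card (E i))"
      using nonempty[OF i] finE[OF i] by (simp add: Suc_le_eq card_gt_0_iff)
    from mult_left_mono[OF this w_nonneg[OF i]] show "w i \<le> w i * (\<Sum>T\<in>E i. 1)" by simp
  qed
  also have "\<dots> \<le> B * (\<Sum>T\<in>U. 1)" by (rule sum_edges_le) simp
  finally show ?thesis by simp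
qed

lemma edge_card_bounds:
  assumes "i \<in> I"
  shows "real (card (E i)) \<ge> 1" "real (card (E i)) \<le> real r" "real (card (E i)) ^ 2 \<le> real r ^ 2"
proof -
  show "real (card (E i)) \<ge> 1"
    using nonempty[OF assms] finE[OF assms] by (simp add: Suc_le_eq card_gt_0_iff)
  show "real (card (E i)) \<le> real r" using card_le[OF assms] by simp
  then show "real (card (E i)) ^ 2 \<le> real r ^ 2" by (intro power_mono) auto
qed

context
  fixes \<eta> :: real
  assumes eta: "0 < \<eta>" "\<eta> \<le> 1" and B1: "B \<ge> 1" and delta1: "\<delta> \<le> 1"
begin

text \<open>A perturbation of the ideal case of degree 1, where a point survives with probability
  \<open>exp (- \<eta>)\<close>.\<close>

lemma survive_le:
  assumes T: "T \<in> U"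
  shows "exp (- \<eta> * wdegree I E w T) \<le> exp (- \<eta>) + exp_bound r B * \<bar>deficit T\<bar>"
proof -
  have d: "\<bar>\<eta> * deficit T\<bar> \<le> \<bar>deficit T\<bar>"
    using eta mult_right_mono[of \<eta> 1 "\<bar>deficit T\<bar>"] by (simp add: abs_mult)
  have "1 * B \<le> (real r + 1) * B" using B1 by (intro mult_right_mono) auto
  then have "\<bar>\<eta> * deficit T\<bar> \<le> (real r + 1) * B + 4 * real r ^ 2"
    using d abs_deficit_le[OF T B1] zero_le_power2[of "real r"] by linarith
  then have "exp (\<eta> * deficit T) \<le> 1 + exp_bound r B * \<bar>\<eta> * deficit T\<bar>"
    by (rule exp_le_exp_bound)
  also have "\<dots> \<le> 1 + exp_bound r B * \<bar>deficit T\<bar>"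
    using d exp_bound_ge_one[of B r] B1 by (intro add_left_mono mult_left_mono) auto
  finally have "exp (- \<eta>) * exp (\<eta> * deficit T) \<le> exp (- \<eta>) * (1 + exp_bound r B * \<bar>deficit T\<bar>)"
    by (intro mult_left_mono) auto
  also have "\<dots> \<le> exp (- \<eta>) + 1 * (exp_bound r B * \<bar>deficit T\<bar>)"
    unfolding distrib_left using eta exp_bound_ge_one[of B r] B1
    by (intro add_mono mult_right_mono) auto
  finally show ?thesis
    by (simp add: deficit_def algebra_simps flip: exp_add)
qed

text \<open>With all degrees 1 and no overlaps, \<open>touch (E i)\<close> would be
  \<open>card (E i)\<close>, and the compensating factor would leave exactly
  \<open>exp (- \<eta>)\<close>. The error terms measure the deviation of the degrees and the
  overlap loss in \<open>touch_ge\<close>.\<close>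

lemma kept_weight_le:
  assumes i: "i \<in> I"
  shows "new_weight \<eta> i * exp (- \<eta> * touch (E i))
    \<le> exp (- \<eta>) * w i + exp_bound r B * (w i * (\<Sum>T\<in>E i. \<bar>deficit T\<bar>) + real r ^ 2 * \<delta> * w i)"
proof -
  let ?k = "real (card (E i))"
  define h where "h = (\<Sum>T\<in>E i. deficit T)"
  define H where "H = (\<Sum>T\<in>E i. \<bar>deficit T\<bar>)"
  define y where "y = \<eta> * (h + ?k ^ 2 * \<delta>)"
  have hH: "\<bar>h\<bar> \<le> H" unfolding h_def H_def by (rule sum_abs)
  have HB: "H \<le> ?k * B" unfolding H_def using sub[OF i] B1 by (intro sum_abs_deficit_le)
  also have "\<dots> \<le> real r * B" using edge_card_bounds[OF i] B1 by (intro mult_right_mono) auto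
  finally have HrB: "H \<le> real r * B" .
  have k2: "0 \<le> ?k ^ 2 * \<delta>" "?k ^ 2 * \<delta> \<le> real r ^ 2 * \<delta>" "real r ^ 2 * \<delta> \<le> real r ^ 2 * 1"
    using edge_card_bounds[OF i] delta_nonneg delta1 by (auto intro!: mult_right_mono mult_left_mono)
  have "\<bar>y\<bar> \<le> 1 * \<bar>h + ?k ^ 2 * \<delta>\<bar>"
    unfolding y_def abs_mult using eta by (intro mult_right_mono) auto
  then have y: "\<bar>y\<bar> \<le> H + real r ^ 2 * \<delta>"
    using hH k2 abs_triangle_ineq[of h "?k ^ 2 * \<delta>"] by simp
  then have "\<bar>y\<bar> \<le> (real r + 1) * B + 4 * real r ^ 2"
    using HrB k2 B1 by (simp add: distrib_right)
  then have "exp y \<le> 1 + exp_bound r B * \<bar>y\<bar>" by (rule exp_le_exp_bound)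
  also have "\<dots> \<le> 1 + exp_bound r B * (H + real r ^ 2 * \<delta>)"
    using y exp_bound_ge_one[of B r] B1 by (intro add_left_mono mult_left_mono) auto
  finally have ey: "exp y \<le> 1 + exp_bound r B * (H + real r ^ 2 * \<delta>)" .
  have "touch (E i) \<ge> ?k - h - ?k ^ 2 * \<delta>"
    using touch_ge[OF sub[OF i]] unfolding sum_wdegree_eq h_def by simp
  then have "\<eta> * (?k - h - ?k ^ 2 * \<delta>) \<le> \<eta> * touch (E i)"
    using eta by (intro mult_left_mono) auto
  then have "\<eta> * (?k - 1) + - \<eta> * touch (E i) \<le> - \<eta> + y"
    unfolding y_def by (simp add: algebra_simps)
  then have "exp (\<eta> * (?k - 1)) * exp (- \<eta> * touch (E i)) \<le> exp (- \<eta>) * exp y"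
    by (simp flip: exp_add)
  also have "\<dots> \<le> exp (- \<eta>) * (1 + exp_bound r B * (H + real r ^ 2 * \<delta>))"
    using ey by (intro mult_left_mono) auto
  also have "\<dots> \<le> exp (- \<eta>) + 1 * (exp_bound r B * (H + real r ^ 2 * \<delta>))"
    unfolding distrib_left[of "exp _"] using eta exp_bound_ge_one[of B r] B1 y
    by (intro add_mono mult_right_mono mult_nonneg_nonneg) auto
  finally have "w i * (exp (\<eta> * (?k - 1)) * exp (- \<eta> * touch (E i)))
      \<le> w i * (exp (- \<eta>) + 1 * (exp_bound r B * (H + real r ^ 2 * \<delta>)))"
    using w_nonneg[OF i] by (intro mult_left_mono)
  then show ?thesis
    unfolding new_weight_def H_def by (simp add: algebra_simps)
qed

lemma expect_kept_le:
  "expect \<eta> (\<lambda>J. \<Sum>i\<in>kept J. new_weight \<eta> i)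
     \<le> exp (- \<eta>) * (\<Sum>i\<in>I. w i) + exp_bound r B * (B * total_deficit + real r ^ 2 * \<delta> * (B * real (card U)))"
proof -
  have "expect \<eta> (\<lambda>J. \<Sum>i\<in>kept J. new_weight \<eta> i)
     \<le> (\<Sum>i\<in>I. exp (- \<eta>) * w i + exp_bound r B * (w i * (\<Sum>T\<in>E i. \<bar>deficit T\<bar>) + real r ^ 2 * \<delta> * w i))"
    unfolding expect_kept by (intro sum_mono kept_weight_le)
  also have "\<dots> = exp (- \<eta>) * (\<Sum>i\<in>I. w i) + exp_bound r B *
      ((\<Sum>i\<in>I. w i * (\<Sum>T\<in>E i. \<bar>deficit T\<bar>)) + real r ^ 2 * \<delta> * (\<Sum>i\<in>I. w i))"
    unfolding sum.distrib sum_distrib_left[symmetric] ..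
  also have "\<dots> \<le> exp (- \<eta>) * (\<Sum>i\<in>I. w i) + exp_bound r B *
      (B * total_deficit + real r ^ 2 * \<delta> * (B * real (card U)))"
    unfolding total_deficit_def
    using exp_bound_ge_one[of B r] B1 delta_nonneg sum_weights_le
    by (intro add_left_mono mult_left_mono add_mono sum_edges_le) auto
  finally show ?thesis .
qed

lemma expect_card_left_le:
  "expect \<eta> (\<lambda>J. real (card (left J))) \<le> exp (- \<eta>) * real (card U) + exp_bound r B * total_deficit"
proof -
  have "expect \<eta> (\<lambda>J. real (card (left J))) \<le> (\<Sum>T\<in>U. exp (- \<eta>) + exp_bound r B * \<bar>deficit T\<bar>)"
    unfolding expect_card_left by (intro sum_mono survive_le)
  then show ?thesis by (simp add: sum.distrib total_deficit_def mult.commute flip: sum_distrib_left)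
qed

text \<open>Up to overlaps, \<open>w i * growth T i\<close> is the expected new weight of
  \<open>i\<close> conditioned on \<open>T\<close> being left: the compensating factor cancels the
  survival of the other points except for their deficits.\<close>

definition growth :: "'x \<Rightarrow> 'i \<Rightarrow> real" where
  "growth T i = exp (\<eta> * (\<Sum>T'\<in>E i - {T}. deficit T'))"

lemma growth_bounds:
  assumes i: "i \<in> I"
  shows "\<bar>growth T i - 1\<bar> \<le> exp_bound r B * (\<Sum>T'\<in>E i. \<bar>deficit T'\<bar>)" "growth T i \<le> exp_bound r B"
proof -
  let ?h = "\<Sum>T'\<in>E i - {T}. deficit T'" and ?H = "\<Sum>T'\<in>E i. \<bar>deficit T'\<bar>"
  have "\<bar>?h\<bar> \<le> (\<Sum>T'\<in>E i - {T}. \<bar>deficit T'\<bar>)" by (rule sum_abs)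
  also have "\<dots> \<le> ?H" using finE[OF i] by (intro sum_mono2) auto
  finally have h: "\<bar>?h\<bar> \<le> ?H" .
  have "\<bar>\<eta> * ?h\<bar> \<le> 1 * \<bar>?h\<bar>" unfolding abs_mult using eta by (intro mult_right_mono) auto
  then have y: "\<bar>\<eta> * ?h\<bar> \<le> ?H" using h by linarith
  have "?H \<le> real (card (E i)) * B" using sub[OF i] B1 by (intro sum_abs_deficit_le)
  also have "\<dots> \<le> real r * B" using edge_card_bounds[OF i] B1 by (intro mult_right_mono) auto
  finally have "\<bar>\<eta> * ?h\<bar> \<le> real r * B" using y by linarith
  then have b: "\<bar>\<eta> * ?h\<bar> \<le> (real r + 1) * B + 4 * real r ^ 2"
    using B1 zero_le_power2[of "real r"] unfolding distrib_right by linarith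
  have "\<bar>growth T i - 1\<bar> \<le> exp_bound r B * \<bar>\<eta> * ?h\<bar>"
    unfolding growth_def by (rule exp_le_exp_bound(1)[OF b])
  also have "\<dots> \<le> exp_bound r B * ?H"
    using y exp_bound_ge_one[of B r] B1 by (intro mult_left_mono) auto
  finally show "\<bar>growth T i - 1\<bar> \<le> exp_bound r B * ?H" .
  show "growth T i \<le> exp_bound r B"
    unfolding growth_def by (rule exp_le_exp_bound(3)[OF b])
qed

lemma sum_wdegree_edge:
  assumes "i \<in> I" "T \<in> E i"
  shows "(\<Sum>T'\<in>E i. wdegree I E w T')
    = wdegree I E w T + (real (card (E i)) - 1) - (\<Sum>T'\<in>E i - {T}. deficit T')"
proof -
  have "(\<Sum>T'\<in>E i. wdegree I E w T') = wdegree I E w T + (\<Sum>T'\<in>E i - {T}. wdegree I E w T')"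
    using finE assms by (intro sum.remove) auto
  moreover have "real (card (E i - {T})) = real (card (E i)) - 1"
    using edge_card_bounds(1)[OF assms(1)] assms finE by (simp add: of_nat_diff)
  ultimately show ?thesis unfolding sum_wdegree_eq[of "E i - {T}"] by simp
qed

text \<open>The linear term enters the defect with a minus sign and so has to be bounded from below.
  The union bound \<open>touch_le\<close> points in this direction and brings no overlap
  error.\<close>

lemma linear_term_ge:
  assumes i: "i \<in> I" and T: "T \<in> E i"
  shows "exp (- \<eta> * wdegree I E w T) * (w i * growth T i) \<le> new_weight \<eta> i * exp (- \<eta> * touch (E i))"
proof -
  have "touch (E i) \<le> wdegree I E w T + (real (card (E i)) - 1) - (\<Sum>T'\<in>E i - {T}. deficit T')"
    using touch_le[OF sub[OF i]] sum_wdegree_edge[OF i T] by simp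
  from mult_left_mono[OF this, of \<eta>]
  have "- \<eta> * wdegree I E w T + \<eta> * (\<Sum>T'\<in>E i - {T}. deficit T')
      \<le> \<eta> * (real (card (E i)) - 1) + - \<eta> * touch (E i)"
    using eta by (simp add: algebra_simps)
  then have "exp (- \<eta> * wdegree I E w T) * growth T i
      \<le> exp (\<eta> * (real (card (E i)) - 1)) * exp (- \<eta> * touch (E i))"
    unfolding growth_def by (simp flip: exp_add)
  from mult_left_mono[OF this w_nonneg[OF i]] show ?thesis
    unfolding new_weight_def by (simp add: mult_ac)
qed

text \<open>If the hyperedges meet only in \<open>T\<close>, the degree sum over their union counts
  \<open>T\<close> once, so conditioned on \<open>T\<close> the two survive almost independently;
  \<open>card (E i \<union> E j) \<le> 2 * r\<close> gives the factor \<open>4 * r ^ 2\<close>. All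
  other pairs get a crude bound, which suffices since \<open>overlap_le\<close> makes their total
  weight small.\<close>

lemma quadratic_term_le:
  assumes i: "i \<in> I" "T \<in> E i" and j: "j \<in> I" "T \<in> E j"
  shows "new_weight \<eta> i * new_weight \<eta> j * exp (- \<eta> * touch (E i \<union> E j))
    \<le> exp (4 * real r ^ 2 * \<delta>) * exp (- \<eta> * wdegree I E w T) * ((w i * growth T i) * (w j * growth T j))
      + exp (2 * real r) * (w i * w j * of_bool (E i \<inter> E j \<noteq> {T}))"
proof (cases "E i \<inter> E j = {T}")
  case True
  let ?ki = "real (card (E i))" and ?kj = "real (card (E j))" and ?A = "E i \<union> E j"
  have fin: "finite (E i)" "finite (E j)" using finE i j by auto
  have A: "?A \<subseteq> U" using sub i j by blast
  have cA: "card ?A \<le> 2 * r"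
    using card_Un_le[of "E i" "E j"] card_le[OF i(1)] card_le[OF j(1)] by linarith
  have "(\<Sum>T'\<in>E i. wdegree I E w T') + (\<Sum>T'\<in>E j. wdegree I E w T')
      = (\<Sum>T'\<in>?A. wdegree I E w T') + wdegree I E w T"
    using sum.union_inter[OF fin, of "wdegree I E w"] True by simp
  then have sumA: "(\<Sum>T'\<in>?A. wdegree I E w T') = wdegree I E w T + (?ki - 1) + (?kj - 1)
      - (\<Sum>T'\<in>E i - {T}. deficit T') - (\<Sum>T'\<in>E j - {T}. deficit T')"
    unfolding sum_wdegree_edge[OF i] sum_wdegree_edge[OF j] by simp
  have "real (card ?A) ^ 2 \<le> (2 * real r) ^ 2"
    using cA by (intro power_mono) auto
  then have "real (card ?A) ^ 2 * \<delta> \<le> 4 * real r ^ 2 * \<delta>"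
    using delta_nonneg by (intro mult_right_mono) (auto simp: power_mult_distrib)
  then have "touch ?A \<ge> wdegree I E w T + (?ki - 1) + (?kj - 1)
      - (\<Sum>T'\<in>E i - {T}. deficit T') - (\<Sum>T'\<in>E j - {T}. deficit T') - 4 * real r ^ 2 * \<delta>"
    using touch_ge[OF A] sumA by simp
  from mult_left_mono[OF this, of \<eta>]
  have "\<eta> * (?ki - 1) + \<eta> * (?kj - 1) + - \<eta> * touch ?A
      \<le> \<eta> * (4 * real r ^ 2 * \<delta>) + - \<eta> * wdegree I E w T
        + (\<eta> * (\<Sum>T'\<in>E i - {T}. deficit T') + \<eta> * (\<Sum>T'\<in>E j - {T}. deficit T'))"
    using eta by (simp add: algebra_simps)
  also have "\<eta> * (4 * real r ^ 2 * \<delta>) \<le> 1 * (4 * real r ^ 2 * \<delta>)"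
    using eta delta_nonneg by (intro mult_right_mono) auto
  finally have "exp (\<eta> * (?ki - 1) + \<eta> * (?kj - 1) + - \<eta> * touch ?A)
      \<le> exp (1 * (4 * real r ^ 2 * \<delta>) + - \<eta> * wdegree I E w T
        + (\<eta> * (\<Sum>T'\<in>E i - {T}. deficit T') + \<eta> * (\<Sum>T'\<in>E j - {T}. deficit T')))"
    by simp
  then have "exp (\<eta> * (?ki - 1)) * exp (\<eta> * (?kj - 1)) * exp (- \<eta> * touch ?A)
      \<le> exp (4 * real r ^ 2 * \<delta>) * exp (- \<eta> * wdegree I E w T) * (growth T i * growth T j)"
    unfolding growth_def exp_add by simp
  from mult_left_mono[OF this, of "w i * w j"] show ?thesis
    using w_nonneg i j True unfolding new_weight_def by (simp add: mult_ac)
next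
  case False
  have "touch (E i \<union> E j) \<ge> 0"
    unfolding touch_def using w_nonneg by (intro sum_nonneg) auto
  then have t: "\<eta> * touch (E i \<union> E j) \<ge> 0" using eta by simp
  have "\<eta> * (real (card (E i)) - 1) \<le> 1 * real r" "\<eta> * (real (card (E j)) - 1) \<le> 1 * real r"
    using eta edge_card_bounds[OF i(1)] edge_card_bounds[OF j(1)] by (auto intro!: mult_mono simp del: mult_1)
  then have "exp (\<eta> * (real (card (E i)) - 1) + \<eta> * (real (card (E j)) - 1) + - \<eta> * touch (E i \<union> E j)) \<le> exp (2 * real r)"
    using t by simp
  then have "exp (\<eta> * (real (card (E i)) - 1)) * exp (\<eta> * (real (card (E j)) - 1)) * exp (- \<eta> * touch (E i \<union> E j)) \<le> exp (2 * real r)"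
    unfolding exp_add .
  from mult_left_mono[OF this, of "w i * w j"]
  have "new_weight \<eta> i * new_weight \<eta> j * exp (- \<eta> * touch (E i \<union> E j)) \<le> exp (2 * real r) * (w i * w j)"
    using w_nonneg i j unfolding new_weight_def by (simp add: mult_ac)
  moreover have "0 \<le> exp (4 * real r ^ 2 * \<delta>) * exp (- \<eta> * wdegree I E w T) * ((w i * growth T i) * (w j * growth T j))"
    using w_nonneg i j unfolding growth_def by simp
  ultimately show ?thesis using False by simp
qed

text \<open>A further common point can be chosen in at most \<open>r\<close> ways inside
  \<open>E i\<close>, and each choice leaves weight at most \<delta> for \<open>j\<close>. Pairs
  with \<open>i = j\<close> are covered too, since the codegree bound also limits the weight of a
  single hyperedge with at least two points.\<close>

lemma overlap_le:
  assumes T: "T \<in> U"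
  shows "(\<Sum>i | i \<in> I \<and> T \<in> E i. \<Sum>j | j \<in> I \<and> T \<in> E j. w i * w j * of_bool (E i \<inter> E j \<noteq> {T}))
    \<le> B * real r * \<delta>"
proof -
  let ?I = "{i \<in> I. T \<in> E i}"
  have finIT: "finite ?I" using finI by simp
  have "(\<Sum>j\<in>?I. w i * w j * of_bool (E i \<inter> E j \<noteq> {T})) \<le> w i * (real r * \<delta>)" if i: "i \<in> ?I" for i
  proof -
    have "(\<Sum>j\<in>?I. w j * of_bool (E i \<inter> E j \<noteq> {T})) \<le> (\<Sum>j\<in>?I. \<Sum>T'\<in>E i - {T}. w j * of_bool (T' \<in> E j))"
    proof (rule sum_mono)
      fix j assume j: "j \<in> ?I"
      have fin: "finite (E i - {T})" using i finE by auto
      have "of_bool (E i \<inter> E j \<noteq> {T}) \<le> (\<Sum>T'\<in>E i - {T}. of_bool (T' \<in> E j) :: real)"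
      proof (cases "E i \<inter> E j = {T}")
        case False
        then obtain T' where T': "T' \<in> E i - {T}" "T' \<in> E j" using i j by auto
        have "of_bool (T' \<in> E j) \<le> (\<Sum>T'\<in>E i - {T}. of_bool (T' \<in> E j) :: real)"
          using T' fin by (intro member_le_sum) auto
        then show ?thesis using T' False by simp
      qed (simp add: sum_nonneg)
      then show "w j * of_bool (E i \<inter> E j \<noteq> {T}) \<le> (\<Sum>T'\<in>E i - {T}. w j * of_bool (T' \<in> E j))"
        unfolding sum_distrib_left[symmetric] using w_nonneg j by (intro mult_left_mono) auto
    qed
    also have "\<dots> = (\<Sum>T'\<in>E i - {T}. \<Sum>j\<in>?I. w j * of_bool (T' \<in> E j))"
      by (rule sum.swap)
    also have "\<dots> \<le> (\<Sum>T'\<in>E i - {T}. \<delta>)"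
    proof (rule sum_mono)
      fix T' assume T': "T' \<in> E i - {T}"
      have "(\<Sum>j\<in>?I. w j * of_bool (T' \<in> E j)) = (\<Sum>j | j \<in> ?I \<and> T' \<in> E j. w j)"
        by (rule sum_mult_of_bool[OF finIT])
      also have "{j. j \<in> ?I \<and> T' \<in> E j} = {j. j \<in> I \<and> T \<in> E j \<and> T' \<in> E j}" by auto
      also have "(\<Sum>j\<in>\<dots>. w j) \<le> \<delta>"
        using T' T i sub by (intro codegree_le) auto
      finally show "(\<Sum>j\<in>?I. w j * of_bool (T' \<in> E j)) \<le> \<delta>" .
    qed
    also have "\<dots> = real (card (E i - {T})) * \<delta>" by simp
    also have "\<dots> \<le> real r * \<delta>"
    proof (intro mult_right_mono delta_nonneg)
      have "card (E i - {T}) \<le> card (E i)" by (rule card_Diff1_le)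
      then show "real (card (E i - {T})) \<le> real r" using i card_le[of i] by simp
    qed
    finally have "(\<Sum>j\<in>?I. w j * of_bool (E i \<inter> E j \<noteq> {T})) \<le> real r * \<delta>" .
    from mult_left_mono[OF this, of "w i"] show ?thesis
      using i w_nonneg by (simp add: sum_distrib_left mult.assoc)
  qed
  then have "(\<Sum>i\<in>?I. \<Sum>j\<in>?I. w i * w j * of_bool (E i \<inter> E j \<noteq> {T})) \<le> (\<Sum>i\<in>?I. w i * (real r * \<delta>))"
    by (rule sum_mono)
  also have "\<dots> = wdegree I E w T * (real r * \<delta>)"
    by (simp add: wdegree_def sum_distrib_right)
  also have "\<dots> \<le> B * (real r * \<delta>)"
    using degree_le[OF T] delta_nonneg by (intro mult_right_mono) auto
  finally show ?thesis by simp
qed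

lemma abs_one_minus_growth_sum_le:
  "\<bar>1 - (\<Sum>i | i \<in> I \<and> T \<in> E i. w i * growth T i)\<bar>
    \<le> \<bar>deficit T\<bar> + (\<Sum>i | i \<in> I \<and> T \<in> E i. w i * (exp_bound r B * (\<Sum>T'\<in>E i. \<bar>deficit T'\<bar>)))"
proof -
  let ?I = "{i \<in> I. T \<in> E i}"
  have "1 - (\<Sum>i\<in>?I. w i * growth T i) = deficit T - (\<Sum>i\<in>?I. w i * (growth T i - 1))"
    by (simp add: deficit_def wdegree_def right_diff_distrib sum_subtractf)
  also have "\<bar>\<dots>\<bar> \<le> \<bar>deficit T\<bar> + \<bar>\<Sum>i\<in>?I. w i * (growth T i - 1)\<bar>"
    by (rule abs_triangle_ineq4)
  also have "\<bar>\<Sum>i\<in>?I. w i * (growth T i - 1)\<bar> \<le> (\<Sum>i\<in>?I. \<bar>w i * (growth T i - 1)\<bar>)"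
    by (rule sum_abs)
  also have "\<dots> \<le> (\<Sum>i\<in>?I. w i * (exp_bound r B * (\<Sum>T'\<in>E i. \<bar>deficit T'\<bar>)))"
  proof (rule sum_mono)
    fix i assume i: "i \<in> ?I"
    then show "\<bar>w i * (growth T i - 1)\<bar> \<le> w i * (exp_bound r B * (\<Sum>T'\<in>E i. \<bar>deficit T'\<bar>))"
      unfolding abs_mult using growth_bounds(1)[of i T] w_nonneg[of i] by (simp add: mult_left_mono)
  qed
  finally show ?thesis by simp
qed

text \<open>The first summand pays for the factor \<open>exp (4 * r ^ 2 * \<delta>)\<close> on
  nearly independent pairs, the second for the overlapping pairs.\<close>

definition defect_slope :: real where
  "defect_slope = 4 * real r ^ 2 * exp_bound r B * (B * exp_bound r B) ^ 2 + exp (2 * real r) * (B * real r)"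

text \<open>The leading terms form the perfect square \<open>p * (1 - S)\<^sup>2\<close>, where
  \<open>S\<close> is the approximate expected new degree given that \<open>T\<close> is left. So
  the variance contributes only terms of order \<delta>. As \<open>S\<close> is bounded, one factor
  of the square is replaced by a constant and the bound becomes linear in the deficits.\<close>

lemma defect_term_le:
  assumes T: "T \<in> U"
  shows "exp (- \<eta> * wdegree I E w T)
        - 2 * (\<Sum>i | i \<in> I \<and> T \<in> E i. new_weight \<eta> i * exp (- \<eta> * touch (E i)))
        + (\<Sum>i | i \<in> I \<and> T \<in> E i. \<Sum>j | j \<in> I \<and> T \<in> E j.
             new_weight \<eta> i * new_weight \<eta> j * exp (- \<eta> * touch (E i \<union> E j)))
    \<le> (1 + B * exp_bound r B) * (\<bar>deficit T\<bar>
        + (\<Sum>i | i \<in> I \<and> T \<in> E i. w i * (exp_bound r B * (\<Sum>T'\<in>E i. \<bar>deficit T'\<bar>))))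
      + defect_slope * \<delta>"
proof -
  let ?I = "{i \<in> I. T \<in> E i}"
  let ?X = "exp_bound r B"
  define p where "p = exp (- \<eta> * wdegree I E w T)"
  define S where "S = (\<Sum>i\<in>?I. w i * growth T i)"
  define e where "e = exp (4 * real r ^ 2 * \<delta>)"
  have X1: "?X \<ge> 1" using exp_bound_ge_one B1 by simp
  have p: "0 \<le> p" "p \<le> 1" using eta wdegree_nonneg[of T] by (auto simp: p_def)
  have S0: "S \<ge> 0" unfolding S_def growth_def using w_nonneg by (intro sum_nonneg) auto
  have "S \<le> (\<Sum>i\<in>?I. w i * ?X)"
    unfolding S_def using growth_bounds(2) w_nonneg by (intro sum_mono mult_left_mono) auto
  also have "\<dots> = wdegree I E w T * ?X" by (simp add: wdegree_def sum_distrib_right)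
  also have "\<dots> \<le> B * ?X" using degree_le[OF T] X1 by (intro mult_right_mono) auto
  finally have SB: "S \<le> B * ?X" .
  have r\<delta>: "0 \<le> 4 * real r ^ 2 * \<delta>" "4 * real r ^ 2 * \<delta> \<le> 4 * real r ^ 2 * 1"
    using delta_nonneg delta1 mult_left_mono[of \<delta> 1 "real r ^ 2"] by auto
  have "0 \<le> (real r + 1) * B" using B1 by simp
  then have "\<bar>4 * real r ^ 2 * \<delta>\<bar> \<le> (real r + 1) * B + 4 * real r ^ 2" using r\<delta> by linarith
  from exp_le_exp_bound(2)[OF this] have e: "e \<le> 1 + ?X * (4 * real r ^ 2 * \<delta>)"
    using r\<delta> unfolding e_def by simp
  have lin: "p * S \<le> (\<Sum>i\<in>?I. new_weight \<eta> i * exp (- \<eta> * touch (E i)))"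
    unfolding S_def p_def sum_distrib_left by (intro sum_mono linear_term_ge) auto
  have "(\<Sum>i\<in>?I. \<Sum>j\<in>?I. new_weight \<eta> i * new_weight \<eta> j * exp (- \<eta> * touch (E i \<union> E j)))
      \<le> (\<Sum>i\<in>?I. \<Sum>j\<in>?I. e * p * ((w i * growth T i) * (w j * growth T j))
          + exp (2 * real r) * (w i * w j * of_bool (E i \<inter> E j \<noteq> {T})))"
    unfolding e_def p_def by (intro sum_mono quadratic_term_le) auto
  also have "\<dots> = e * p * (\<Sum>i\<in>?I. \<Sum>j\<in>?I. (w i * growth T i) * (w j * growth T j))
      + exp (2 * real r) * (\<Sum>i\<in>?I. \<Sum>j\<in>?I. w i * w j * of_bool (E i \<inter> E j \<noteq> {T}))"
    unfolding sum.distrib sum_distrib_left[symmetric] ..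
  also have "(\<Sum>i\<in>?I. \<Sum>j\<in>?I. (w i * growth T i) * (w j * growth T j)) = S * S"
    unfolding S_def sum_product ..
  also have "exp (2 * real r) * (\<Sum>i\<in>?I. \<Sum>j\<in>?I. w i * w j * of_bool (E i \<inter> E j \<noteq> {T}))
      \<le> exp (2 * real r) * (B * real r * \<delta>)"
    by (intro mult_left_mono overlap_le T) auto
  also have "e * p * (S * S) \<le> p * (S * S) + 4 * real r ^ 2 * ?X * (B * ?X) ^ 2 * \<delta>"
  proof -
    have "e * (p * (S * S)) \<le> (1 + ?X * (4 * real r ^ 2 * \<delta>)) * (p * (S * S))"
      using e p by (intro mult_right_mono) auto
    also have "\<dots> = p * (S * S) + ?X * (4 * real r ^ 2 * \<delta>) * (p * (S * S))"
      by (simp add: algebra_simps)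
    also have "p * (S * S) \<le> 1 * ((B * ?X) * (B * ?X))"
      using p S0 SB by (intro mult_mono) auto
    then have "?X * (4 * real r ^ 2 * \<delta>) * (p * (S * S)) \<le> ?X * (4 * real r ^ 2 * \<delta>) * (1 * ((B * ?X) * (B * ?X)))"
      using r\<delta> X1 by (intro mult_left_mono) auto
    also have "\<dots> = 4 * real r ^ 2 * ?X * (B * ?X) ^ 2 * \<delta>"
      by (simp add: power2_eq_square mult_ac)
    finally show ?thesis by (simp add: mult.assoc)
  qed
  finally have "p - 2 * (\<Sum>i\<in>?I. new_weight \<eta> i * exp (- \<eta> * touch (E i)))
      + (\<Sum>i\<in>?I. \<Sum>j\<in>?I. new_weight \<eta> i * new_weight \<eta> j * exp (- \<eta> * touch (E i \<union> E j)))
      \<le> p - 2 * (p * S) + (p * (S * S) + 4 * real r ^ 2 * ?X * (B * ?X) ^ 2 * \<delta> + exp (2 * real r) * (B * real r * \<delta>))"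
    using lin by linarith
  also have "\<dots> = p * (1 - S)\<^sup>2 + defect_slope * \<delta>"
    unfolding defect_slope_def by (simp add: power2_eq_square algebra_simps)
  also have "p * (1 - S)\<^sup>2 \<le> 1 * (1 - S)\<^sup>2" using p by (intro mult_right_mono) auto
  also have "1 * (1 - S)\<^sup>2 = \<bar>1 - S\<bar> * \<bar>1 - S\<bar>" by (simp add: power2_eq_square)
  also have "\<dots> \<le> (1 + B * ?X) * \<bar>1 - S\<bar>"
    using S0 SB by (intro mult_right_mono) auto
  also have "\<dots> \<le> (1 + B * ?X) * (\<bar>deficit T\<bar>
        + (\<Sum>i\<in>?I. w i * (exp_bound r B * (\<Sum>T'\<in>E i. \<bar>deficit T'\<bar>))))"
    unfolding S_def using abs_one_minus_growth_sum_le S0 SB B1 X1 by (intro mult_left_mono) auto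
  finally show ?thesis unfolding p_def by simp
qed

lemma expect_defect_le:
  "expect \<eta> (\<lambda>J. \<Sum>T\<in>left J. (1 - wdegree (kept J) E (new_weight \<eta>) T)\<^sup>2)
   \<le> (1 + B * exp_bound r B) * ((1 + real r * exp_bound r B * B) * total_deficit) + defect_slope * \<delta> * real (card U)"
proof -
  let ?X = "exp_bound r B"
  have X1: "?X \<ge> 1" using exp_bound_ge_one B1 by simp
  define z where "z i = w i * (?X * (\<Sum>T'\<in>E i. \<bar>deficit T'\<bar>))" for i
  have z: "z i \<ge> 0" if "i \<in> I" for i
    unfolding z_def using w_nonneg[OF that] X1 by (intro mult_nonneg_nonneg sum_nonneg) auto
  have "(\<Sum>T\<in>U. \<Sum>i | i \<in> I \<and> T \<in> E i. z i) = (\<Sum>T\<in>U. \<Sum>i\<in>I. z i * of_bool (T \<in> E i))"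
    unfolding sum_mult_of_bool[OF finI] ..
  also have "\<dots> = (\<Sum>i\<in>I. \<Sum>T\<in>U. z i * of_bool (T \<in> E i))" by (rule sum.swap)
  also have "\<dots> \<le> (\<Sum>i\<in>I. real r * z i)"
  proof (rule sum_mono)
    fix i assume i: "i \<in> I"
    have "(\<Sum>T\<in>U. z i * of_bool (T \<in> E i)) = (\<Sum>T | T \<in> U \<and> T \<in> E i. z i)"
      by (rule sum_mult_of_bool[OF finU])
    also have "{T. T \<in> U \<and> T \<in> E i} = E i" using sub[OF i] by auto
    also have "(\<Sum>T\<in>E i. z i) = real (card (E i)) * z i" by simp
    also have "\<dots> \<le> real r * z i" using z[OF i] edge_card_bounds[OF i] by (intro mult_right_mono)
    finally show "(\<Sum>T\<in>U. z i * of_bool (T \<in> E i)) \<le> real r * z i" .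
  qed
  also have "\<dots> = real r * ?X * (\<Sum>i\<in>I. w i * (\<Sum>T'\<in>E i. \<bar>deficit T'\<bar>))"
    unfolding z_def sum_distrib_left by (simp add: mult_ac)
  also have "\<dots> \<le> real r * ?X * (B * total_deficit)"
    unfolding total_deficit_def using X1 by (intro mult_left_mono sum_edges_le) auto
  finally have zsum: "(\<Sum>T\<in>U. \<Sum>i | i \<in> I \<and> T \<in> E i. z i) \<le> real r * ?X * (B * total_deficit)" .
  have "expect \<eta> (\<lambda>J. \<Sum>T\<in>left J. (1 - wdegree (kept J) E (new_weight \<eta>) T)\<^sup>2)
     \<le> (\<Sum>T\<in>U. (1 + B * ?X) * (\<bar>deficit T\<bar> + (\<Sum>i | i \<in> I \<and> T \<in> E i. z i)) + defect_slope * \<delta>)"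
    unfolding expect_defect z_def by (intro sum_mono defect_term_le)
  also have "\<dots> = (1 + B * ?X) * (total_deficit + (\<Sum>T\<in>U. \<Sum>i | i \<in> I \<and> T \<in> E i. z i)) + defect_slope * \<delta> * real (card U)"
    unfolding total_deficit_def sum.distrib sum_distrib_left[symmetric] by (simp add: mult.commute)
  also have "\<dots> \<le> (1 + B * ?X) * (total_deficit + real r * ?X * (B * total_deficit)) + defect_slope * \<delta> * real (card U)"
    using zsum B1 X1 by (intro add_right_mono mult_left_mono add_left_mono) auto
  finally show ?thesis by (simp add: algebra_simps)
qed

end
end

section \<open>One good outcome and the iteration over rounds\<close>

definition step_const :: "nat \<Rightarrow> real \<Rightarrow> real" where
  "step_const r B = exp_bound r B * (1 + B + real r ^ 2 * B)
     + (1 + B * exp_bound r B) * (1 + real r * exp_bound r B * B)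
     + 4 * real r ^ 2 * exp_bound r B * (B * exp_bound r B) ^ 2 + exp (2 * real r) * (B * real r)"

lemma (in weighted_hypergraph) nibble_step:
  assumes eta: "0 < \<eta>" "\<eta> \<le> 1" and B1: "B \<ge> 1" and delta1: "\<delta> \<le> 1" and abc: "a \<ge> 0" "b \<ge> 0" "c \<ge> 0"
  shows "\<exists>J\<subseteq>I. real (card J) + a * (\<Sum>i\<in>kept J. new_weight \<eta> i) + c * real (card (left J))
      + b * (\<Sum>T\<in>left J. (1 - wdegree (kept J) E (new_weight \<eta>) T)\<^sup>2)
    \<le> (\<eta> + a * exp (- \<eta>)) * (\<Sum>i\<in>I. w i) + c * (exp (- \<eta>) * real (card U))
      + (a + b + c) * (step_const r B * (total_deficit + \<delta> * real (card U)))"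
proof -
  let ?X = "exp_bound r B" and ?C = "step_const r B"
  let ?F = "\<Sum>i\<in>I. w i" and ?N = "real (card U)" and ?L = "total_deficit"
  have X1: "?X \<ge> 1" using exp_bound_ge_one B1 by simp
  have L0: "?L \<ge> 0" unfolding total_deficit_def by (intro sum_nonneg) auto
  have \<delta>N: "\<delta> * ?N \<ge> 0" using delta_nonneg by simp
  let ?s = "4 * real r ^ 2 * ?X * (B * ?X) ^ 2 + exp (2 * real r) * (B * real r)"
  have nn: "0 \<le> ?X" "0 \<le> ?X * B" "0 \<le> ?X * (real r ^ 2 * B)" "0 \<le> ?s"
      "0 \<le> (1 + B * ?X) * (1 + real r * ?X * B)"
    using X1 B1 by auto
  have C: "?C = ?X + ?X * B + ?X * (real r ^ 2 * B) + (1 + B * ?X) * (1 + real r * ?X * B) + ?s"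
    unfolding step_const_def by (simp add: algebra_simps)
  have bounds: "?X \<le> ?C" "?X * B \<le> ?C" "?X * (real r ^ 2 * B) \<le> ?C"
     "(1 + B * ?X) * (1 + real r * ?X * B) \<le> ?C" "?s \<le> ?C" "0 \<le> ?C"
    unfolding C using nn by linarith+
  obtain J where J: "J \<subseteq> I" "real (card J) + a * (\<Sum>i\<in>kept J. new_weight \<eta> i) + c * real (card (left J))
      + b * (\<Sum>T\<in>left J. (1 - wdegree (kept J) E (new_weight \<eta>) T)\<^sup>2)
    \<le> expect \<eta> (\<lambda>J. real (card J) + a * (\<Sum>i\<in>kept J. new_weight \<eta> i) + c * real (card (left J))
      + b * (\<Sum>T\<in>left J. (1 - wdegree (kept J) E (new_weight \<eta>) T)\<^sup>2))"
    using exists_le_expect[of \<eta> "\<lambda>J. real (card J) + a * (\<Sum>i\<in>kept J. new_weight \<eta> i) + c * real (card (left J))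
      + b * (\<Sum>T\<in>left J. (1 - wdegree (kept J) E (new_weight \<eta>) T)\<^sup>2)"] eta by auto
  note J(2)
  also have "expect \<eta> (\<lambda>J. real (card J) + a * (\<Sum>i\<in>kept J. new_weight \<eta> i) + c * real (card (left J))
      + b * (\<Sum>T\<in>left J. (1 - wdegree (kept J) E (new_weight \<eta>) T)\<^sup>2))
    = expect \<eta> (\<lambda>J. real (card J)) + a * expect \<eta> (\<lambda>J. \<Sum>i\<in>kept J. new_weight \<eta> i)
      + c * expect \<eta> (\<lambda>J. real (card (left J)))
      + b * expect \<eta> (\<lambda>J. \<Sum>T\<in>left J. (1 - wdegree (kept J) E (new_weight \<eta>) T)\<^sup>2)"
    unfolding expect_add expect_cmult ..
  also have "\<dots> \<le> \<eta> * ?F + a * (exp (- \<eta>) * ?F + ?C * (?L + \<delta> * ?N))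
      + c * (exp (- \<eta>) * ?N + ?C * (?L + \<delta> * ?N)) + b * (?C * (?L + \<delta> * ?N))"
  proof (intro add_mono mult_left_mono abc)
    show "expect \<eta> (\<lambda>J. real (card J)) \<le> \<eta> * ?F" by (rule expect_card_le)
    have "expect \<eta> (\<lambda>J. \<Sum>i\<in>kept J. new_weight \<eta> i)
        \<le> exp (- \<eta>) * ?F + (?X * B * ?L + ?X * (real r ^ 2 * B) * (\<delta> * ?N))"
      using expect_kept_le[OF eta B1 delta1] by (simp add: algebra_simps)
    also have "\<dots> \<le> exp (- \<eta>) * ?F + (?C * ?L + ?C * (\<delta> * ?N))"
      using bounds L0 \<delta>N by (intro add_left_mono add_mono mult_right_mono) auto
    finally show "expect \<eta> (\<lambda>J. \<Sum>i\<in>kept J. new_weight \<eta> i) \<le> exp (- \<eta>) * ?F + ?C * (?L + \<delta> * ?N)"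
      by (simp add: distrib_left)
    have "expect \<eta> (\<lambda>J. real (card (left J))) \<le> exp (- \<eta>) * ?N + ?X * ?L"
      by (rule expect_card_left_le[OF eta B1 delta1])
    also have "\<dots> \<le> exp (- \<eta>) * ?N + ?C * (?L + \<delta> * ?N)"
      using bounds L0 \<delta>N by (intro add_left_mono mult_mono) auto
    finally show "expect \<eta> (\<lambda>J. real (card (left J))) \<le> exp (- \<eta>) * ?N + ?C * (?L + \<delta> * ?N)" .
    have "expect \<eta> (\<lambda>J. \<Sum>T\<in>left J. (1 - wdegree (kept J) E (new_weight \<eta>) T)\<^sup>2)
        \<le> ((1 + B * ?X) * (1 + real r * ?X * B)) * ?L + ?s * (\<delta> * ?N)"
      using expect_defect_le[OF eta B1 delta1] unfolding defect_slope_def[OF eta B1 delta1]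
      by (simp only: mult.assoc)
    also have "\<dots> \<le> ?C * ?L + ?C * (\<delta> * ?N)"
      using bounds L0 \<delta>N by (intro add_mono mult_right_mono) auto
    finally show "expect \<eta> (\<lambda>J. \<Sum>T\<in>left J. (1 - wdegree (kept J) E (new_weight \<eta>) T)\<^sup>2)
        \<le> ?C * (?L + \<delta> * ?N)" by (simp add: distrib_left)
  qed
  also have "\<dots> = (\<eta> + a * exp (- \<eta>)) * ?F + c * (exp (- \<eta>) * ?N) + (a + b + c) * (?C * (?L + \<delta> * ?N))"
    by (simp add: algebra_simps)
  finally show ?thesis using J(1) by blast
qed

lemma weighted_hypergraph_mono:
  assumes "weighted_hypergraph U I E w r B \<delta>" "\<delta> \<le> \<delta>'"
  shows "weighted_hypergraph U I E w r B \<delta>'"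
proof -
  interpret weighted_hypergraph U I E w r B \<delta> by fact
  show ?thesis
  proof
    fix T T' assume "T \<in> U" "T' \<in> U" "T \<noteq> T'"
    from codegree_le[OF this] show "(\<Sum>i | i \<in> I \<and> T \<in> E i \<and> T' \<in> E i. w i) \<le> \<delta>'"
      using assms(2) by linarith
  qed (use finU finI sub nonempty card_le w_nonneg degree_le delta_nonneg assms(2) in auto)
qed

text \<open>The compensating factor is at most \<open>exp r\<close>, so a round worsens both bounds
  by a constant factor. Over a fixed number of rounds, a sufficiently small initial \<delta> absorbs
  this.\<close>

lemma (in weighted_hypergraph) weighted_hypergraph_kept:
  assumes eta: "0 < \<eta>" "\<eta> \<le> 1" and "B \<ge> 0"
  shows "weighted_hypergraph (left J) (kept J) E (new_weight \<eta>) r (B * exp (real r)) (\<delta> * exp (real r))"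
proof -
  have new: "new_weight \<eta> i \<le> w i * exp (real r)" if i: "i \<in> I" for i
  proof -
    have "\<eta> * (real (card (E i)) - 1) \<le> 1 * real r"
      using eta edge_card_bounds[OF i] by (intro mult_mono) auto
    then show ?thesis unfolding new_weight_def using w_nonneg[OF i] by (intro mult_left_mono) auto
  qed
  have new_sum: "(\<Sum>i\<in>K'. new_weight \<eta> i) \<le> (\<Sum>i\<in>K. w i) * exp (real r)" if "K' \<subseteq> K" "K \<subseteq> I" for K' K
  proof -
    have "(\<Sum>i\<in>K'. new_weight \<eta> i) \<le> (\<Sum>i\<in>K'. w i * exp (real r))"
      using that new by (intro sum_mono) auto
    also have "\<dots> \<le> (\<Sum>i\<in>K. w i * exp (real r))"
      using that w_nonneg finite_subset[OF that(2) finI] by (intro sum_mono2) auto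
    finally show ?thesis by (simp add: sum_distrib_right)
  qed
  show ?thesis
  proof
    show "0 \<le> \<delta> * exp (real r)" using delta_nonneg by simp
    show "finite (left J)" "finite (kept J)" using finU finI by (auto simp: left_def kept_def)
    fix i assume i: "i \<in> kept J"
    then show "E i \<subseteq> left J" by (simp add: kept_def)
    have "i \<in> I" using i by (simp add: kept_def)
    then show "E i \<noteq> {}" "card (E i) \<le> r" "new_weight \<eta> i \<ge> 0"
      using nonempty card_le w_nonneg by (auto simp: new_weight_def)
  next
    fix T assume T: "T \<in> left J"
    have "wdegree (kept J) E (new_weight \<eta>) T \<le> wdegree I E w T * exp (real r)"
      unfolding wdegree_def by (rule new_sum) (auto simp: kept_def)
    also have "\<dots> \<le> B * exp (real r)"
      using T degree_le[of T] by (intro mult_right_mono) (auto simp: left_def)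
    finally show "wdegree (kept J) E (new_weight \<eta>) T \<le> B * exp (real r)" .
    fix T' assume T': "T' \<in> left J" "T \<noteq> T'"
    have "(\<Sum>i | i \<in> kept J \<and> T \<in> E i \<and> T' \<in> E i. new_weight \<eta> i)
        \<le> (\<Sum>i | i \<in> I \<and> T \<in> E i \<and> T' \<in> E i. w i) * exp (real r)"
      by (rule new_sum) (auto simp: kept_def)
    also have "\<dots> \<le> \<delta> * exp (real r)"
      using T T' codegree_le[of T T'] by (intro mult_right_mono) (auto simp: left_def)
    finally show "(\<Sum>i | i \<in> kept J \<and> T \<in> E i \<and> T' \<in> E i. new_weight \<eta> i) \<le> \<delta> * exp (real r)" .
  qed
qed

text \<open>The bound is linear in the total weight, the number of points and the squared degree defect,
  so a single outcome below the expectation controls all three in the next round. Its weight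
  coefficient is preserved because \<open>\<eta> + (1 + \<eta>) * exp (- \<eta>) \<le> 1 + \<eta>\<close>.\<close>

lemma nibble_rounds:
  fixes \<eta> :: real
  assumes \<eta>: "0 < \<eta>" "\<eta> \<le> 1"
  shows "B \<ge> 1 \<Longrightarrow> \<gamma> > 0 \<Longrightarrow> \<exists>b \<delta>. b \<ge> 0 \<and> \<delta> > 0 \<and>
    (\<forall>U I E w. weighted_hypergraph (U :: 'x set) (I :: 'i set) E w r B \<delta> \<longrightarrow>
      (\<exists>J Z. J \<subseteq> I \<and> Z \<subseteq> U \<and> U \<subseteq> Z \<union> (\<Union>i\<in>J. E i) \<and>
         real (card J) + real (card Z) \<le> (1 + \<eta>) * (\<Sum>i\<in>I. w i) + exp (- \<eta> * real k) * real (card U)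
           + b * (\<Sum>T\<in>U. (1 - wdegree I E w T)\<^sup>2) + \<gamma> * real (card U)))"
proof (induction k arbitrary: B \<gamma>)
  case 0
  have "\<exists>J Z. J \<subseteq> I \<and> Z \<subseteq> U \<and> U \<subseteq> Z \<union> (\<Union>i\<in>J. E i) \<and>
         real (card J) + real (card Z) \<le> (1 + \<eta>) * (\<Sum>i\<in>I. w i) + exp (- \<eta> * real 0) * real (card U)
           + 0 * (\<Sum>T\<in>U. (1 - wdegree I E w T)\<^sup>2) + \<gamma> * real (card U)"
    if "weighted_hypergraph U I E w r B 1" for U :: "'x set" and I :: "'i set" and E w
  proof -
    interpret weighted_hypergraph U I E w r B 1 by fact
    have "0 \<le> (1 + \<eta>) * (\<Sum>i\<in>I. w i)" using \<eta> w_nonneg by (intro mult_nonneg_nonneg sum_nonneg) auto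
    moreover have "0 \<le> \<gamma> * real (card U)" using 0 by simp
    ultimately show ?thesis by (intro exI[of _ "{}"] exI[of _ U]) simp
  qed
  then show ?case by (intro exI[where x = "0::real"] exI[where x = "1::real"] conjI allI impI) simp_all
next
  case (Suc k)
  define B' where "B' = B * exp (real r)"
  have "1 * 1 \<le> B * exp (real r)" using Suc.prems by (intro mult_mono) auto
  then have "B' \<ge> 1" unfolding B'_def by simp
  moreover have "\<gamma> / 2 > 0" using Suc.prems by simp
  ultimately obtain b' \<delta>' where b': "b' \<ge> 0" and \<delta>': "\<delta>' > 0" and
    IH: "\<And>U I E w. weighted_hypergraph (U :: 'x set) (I :: 'i set) E w r B' \<delta>' \<Longrightarrow>
      (\<exists>J Z. J \<subseteq> I \<and> Z \<subseteq> U \<and> U \<subseteq> Z \<union> (\<Union>i\<in>J. E i) \<and>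
         real (card J) + real (card Z) \<le> (1 + \<eta>) * (\<Sum>i\<in>I. w i) + exp (- \<eta> * real k) * real (card U)
           + b' * (\<Sum>T\<in>U. (1 - wdegree I E w T)\<^sup>2) + \<gamma> / 2 * real (card U))"
    using Suc.IH[of B' "\<gamma> / 2"] by blast
  have a: "1 + \<eta> \<ge> 0" using \<eta> by simp
  define c where "c = exp (- \<eta> * real k)"
  have c: "0 \<le> c" using \<eta> by (auto simp: c_def)
  define K where "K = (1 + \<eta> + b' + c) * step_const r B"
  have K0: "K \<ge> 0"
    unfolding K_def step_const_def using \<eta> b' c Suc.prems exp_bound_ge_one[of B r]
    by (intro mult_nonneg_nonneg add_nonneg_nonneg) auto
  define \<sigma> where "\<sigma> = \<gamma> / (4 * (K + 1))"
  have \<sigma>: "\<sigma> > 0" "K * \<sigma> \<le> \<gamma> / 4"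
    using K0 Suc.prems by (auto simp: \<sigma>_def field_simps)
  define \<delta> where "\<delta> = min 1 (min (\<delta>' / exp (real r)) \<sigma>)"
  have \<delta>: "\<delta> > 0" "\<delta> \<le> 1" "\<delta> * exp (real r) \<le> \<delta>'" "\<delta> \<le> \<sigma>"
  proof -
    show "\<delta> > 0" "\<delta> \<le> 1" "\<delta> \<le> \<sigma>" using \<delta>' \<sigma> by (auto simp: \<delta>_def)
    have "\<delta> \<le> \<delta>' / exp (real r)" by (simp add: \<delta>_def)
    then show "\<delta> * exp (real r) \<le> \<delta>'" by (simp add: field_simps)
  qed
  have "\<exists>J Z. J \<subseteq> I \<and> Z \<subseteq> U \<and> U \<subseteq> Z \<union> (\<Union>i\<in>J. E i) \<and>
         real (card J) + real (card Z) \<le> (1 + \<eta>) * (\<Sum>i\<in>I. w i) + exp (- \<eta> * real (Suc k)) * real (card U)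
           + K / \<sigma> * (\<Sum>T\<in>U. (1 - wdegree I E w T)\<^sup>2) + \<gamma> * real (card U)"
    if wh: "weighted_hypergraph U I E w r B \<delta>" for U :: "'x set" and I :: "'i set" and E w
  proof -
    interpret weighted_hypergraph U I E w r B \<delta> by fact
    let ?F = "\<Sum>i\<in>I. w i" and ?N = "real (card U)" and ?D = "\<Sum>T\<in>U. (1 - wdegree I E w T)\<^sup>2"
    obtain J where J: "J \<subseteq> I" and le: "real (card J) + (1 + \<eta>) * (\<Sum>i\<in>kept J. new_weight \<eta> i) + c * real (card (left J))
      + b' * (\<Sum>T\<in>left J. (1 - wdegree (kept J) E (new_weight \<eta>) T)\<^sup>2)
    \<le> (\<eta> + (1 + \<eta>) * exp (- \<eta>)) * ?F + c * (exp (- \<eta>) * ?N)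
      + (1 + \<eta> + b' + c) * (step_const r B * (total_deficit + \<delta> * ?N))"
      using nibble_step[OF \<eta> Suc.prems(1) \<delta>(2) a b' c] by blast
    have "weighted_hypergraph (left J) (kept J) E (new_weight \<eta>) r B' (\<delta> * exp (real r))"
      unfolding B'_def using Suc.prems(1) by (intro weighted_hypergraph_kept \<eta>) auto
    then have "weighted_hypergraph (left J) (kept J) E (new_weight \<eta>) r B' \<delta>'"
      using \<delta>(3) by (rule weighted_hypergraph_mono)
    from IH[OF this] obtain J' Z where J': "J' \<subseteq> kept J" "Z \<subseteq> left J" "left J \<subseteq> Z \<union> (\<Union>i\<in>J'. E i)"
      and le': "real (card J') + real (card Z) \<le> (1 + \<eta>) * (\<Sum>i\<in>kept J. new_weight \<eta> i) + c * real (card (left J))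
           + b' * (\<Sum>T\<in>left J. (1 - wdegree (kept J) E (new_weight \<eta>) T)\<^sup>2) + \<gamma> / 2 * real (card (left J))"
      unfolding c_def by blast
    have "total_deficit \<le> \<sigma> * ?N + ?D / \<sigma>"
    proof -
      have "\<bar>deficit T\<bar> \<le> \<sigma> + (1 - wdegree I E w T)\<^sup>2 / \<sigma>" for T
      proof -
        let ?x = "\<bar>deficit T\<bar>"
        have "?x * \<sigma> \<le> \<sigma> * \<sigma> + ?x * ?x"
        proof (cases "?x \<le> \<sigma>")
          case True
          then have "?x * \<sigma> \<le> \<sigma> * \<sigma>" using \<sigma> by (intro mult_right_mono) auto
          moreover have "0 \<le> ?x * ?x" by simp
          ultimately show ?thesis by linarith
        next
          case False
          then have "?x * \<sigma> \<le> ?x * ?x" by (intro mult_left_mono) auto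
          moreover have "0 \<le> \<sigma> * \<sigma>" by simp
          ultimately show ?thesis by linarith
        qed
        moreover have "?x * ?x = (1 - wdegree I E w T)\<^sup>2"
          by (simp add: deficit_def power2_eq_square)
        ultimately have "?x * \<sigma> \<le> \<sigma> * \<sigma> + (1 - wdegree I E w T)\<^sup>2" by simp
        then have "?x \<le> (\<sigma> * \<sigma> + (1 - wdegree I E w T)\<^sup>2) / \<sigma>"
          using \<sigma>(1) by (simp add: pos_le_divide_eq)
        then show ?thesis using \<sigma>(1) by (simp add: add_divide_distrib)
      qed
      then have "total_deficit \<le> (\<Sum>T\<in>U. \<sigma> + (1 - wdegree I E w T)\<^sup>2 / \<sigma>)"
        unfolding total_deficit_def by (rule sum_mono)
      then show ?thesis by (simp add: sum.distrib sum_divide_distrib mult.commute)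
    qed
    moreover have "\<delta> * ?N \<le> \<sigma> * ?N" using \<delta>(4) by (intro mult_right_mono) auto
    ultimately have "K * (total_deficit + \<delta> * ?N) \<le> K * (\<sigma> * ?N + ?D / \<sigma> + \<sigma> * ?N)"
      using K0 by (intro mult_left_mono) auto
    also have "\<dots> = 2 * ((K * \<sigma>) * ?N) + K / \<sigma> * ?D"
      unfolding distrib_left by (simp add: mult.assoc)
    also have "(K * \<sigma>) * ?N \<le> \<gamma> / 4 * ?N" using \<sigma>(2) by (intro mult_right_mono) auto
    finally have err: "(1 + \<eta> + b' + c) * (step_const r B * (total_deficit + \<delta> * ?N)) \<le> \<gamma> / 2 * ?N + K / \<sigma> * ?D"
      unfolding K_def by (simp add: mult.assoc)
    have "left J \<subseteq> U" by (auto simp: left_def)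
    then have "card (left J) \<le> card U" using finU by (rule card_mono[rotated])
    then have left_le: "\<gamma> / 2 * real (card (left J)) \<le> \<gamma> / 2 * ?N"
      using Suc.prems by (intro mult_left_mono) auto
    have "(1 + \<eta>) * exp (- \<eta>) \<le> exp \<eta> * exp (- \<eta>)"
      by (intro mult_right_mono) auto
    also have "\<dots> = 1" by (simp flip: exp_add)
    finally have "\<eta> + (1 + \<eta>) * exp (- \<eta>) \<le> 1 + \<eta>" by simp
    moreover have "?F \<ge> 0" using w_nonneg by (rule sum_nonneg)
    ultimately have F: "(\<eta> + (1 + \<eta>) * exp (- \<eta>)) * ?F \<le> (1 + \<eta>) * ?F" by (rule mult_right_mono)
    have e: "c * (exp (- \<eta>) * ?N) = exp (- \<eta> * real (Suc k)) * ?N"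
      using exp_add[of "- \<eta> * real k" "- \<eta>"] unfolding c_def by (simp add: algebra_simps)
    have card: "real (card (J \<union> J')) \<le> real (card J) + real (card J')"
      using card_Un_le[of J J'] by linarith
    have "u + z \<le> F3 + e' + KD + \<gamma> * N"
      if "u \<le> j + j'" "j' + z \<le> F1 + cl + D1 + gl" "j + F1 + cl + D1 \<le> F2 + e + er"
        "er \<le> \<gamma> / 2 * N + KD" "gl \<le> \<gamma> / 2 * N" "F2 \<le> F3" "e = e'"
      for u j j' z F1 F2 F3 e e' KD N cl D1 gl er :: real
    proof -
      have "\<gamma> * N = \<gamma> / 2 * N + \<gamma> / 2 * N" by (simp add: field_simps)
      then show ?thesis using that by linarith
    qed
    from this[OF card le' le err left_le F e]
    have "real (card (J \<union> J')) + real (card Z) \<le> (1 + \<eta>) * ?F + exp (- \<eta> * real (Suc k)) * ?N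
           + K / \<sigma> * ?D + \<gamma> * ?N" .
    moreover have "J \<union> J' \<subseteq> I" using J J' by (auto simp: kept_def)
    moreover have "Z \<subseteq> U" using J' \<open>left J \<subseteq> U\<close> by auto
    moreover have "U \<subseteq> Z \<union> (\<Union>i\<in>J \<union> J'. E i)"
    proof
      fix T assume "T \<in> U"
      then have "T \<in> left J \<or> T \<in> (\<Union>i\<in>J. E i)" unfolding left_def by blast
      then show "T \<in> Z \<union> (\<Union>i\<in>J \<union> J'. E i)" using J'(3) by auto
    qed
    ultimately show ?thesis by (intro exI[of _ "J \<union> J'"] exI[of _ Z] conjI)
  qed
  moreover have "K / \<sigma> \<ge> 0" using K0 \<sigma> by simp
  ultimately show ?case using \<delta>(1) by (intro exI[of _ "K / \<sigma>"] exI[of _ \<delta>] conjI allI impI)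
qed

text \<open>The coefficient \<open>b\<close> of \<open>nibble_rounds\<close> may be huge, but it
  multiplies the initial squared defect, which is zero when all degrees are exactly 1.\<close>

theorem nibble:
  fixes \<gamma> :: real
  assumes \<gamma>: "\<gamma> > 0"
  shows "\<exists>\<delta>>0. \<forall>U I E w. weighted_hypergraph (U :: 'x set) (I :: 'i set) E w r 1 \<delta> \<and>
      (\<forall>T\<in>U. wdegree I E w T = 1) \<longrightarrow>
      (\<exists>J Z. J \<subseteq> I \<and> Z \<subseteq> U \<and> U \<subseteq> Z \<union> (\<Union>i\<in>J. E i) \<and>
         real (card J) + real (card Z) \<le> (1 + \<gamma>) * (\<Sum>i\<in>I. w i) + \<gamma> * real (card U))"
proof -
  define \<eta> where "\<eta> = min 1 \<gamma>"
  have \<eta>: "0 < \<eta>" "\<eta> \<le> 1" "\<eta> \<le> \<gamma>" using \<gamma> by (auto simp: \<eta>_def)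
  obtain k :: nat where "- ln (\<gamma> / 2) / \<eta> \<le> real k" using real_arch_simple by blast
  then have "- \<eta> * real k \<le> ln (\<gamma> / 2)" using \<eta> by (simp add: field_simps)
  then have k: "exp (- \<eta> * real k) \<le> \<gamma> / 2" using \<gamma>
    using exp_le_cancel_iff[of "- \<eta> * real k" "ln (\<gamma> / 2)"] by simp
  have "\<gamma> / 2 > 0" using \<gamma> by simp
  from nibble_rounds[OF \<eta>(1,2) order_refl this, of r k, where 'x = 'x and 'i = 'i]
  obtain b \<delta> where "\<delta> > 0" and *: "\<And>U I E w. weighted_hypergraph (U :: 'x set) (I :: 'i set) E w r 1 \<delta> \<Longrightarrow>
      (\<exists>J Z. J \<subseteq> I \<and> Z \<subseteq> U \<and> U \<subseteq> Z \<union> (\<Union>i\<in>J. E i) \<and>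
         real (card J) + real (card Z) \<le> (1 + \<eta>) * (\<Sum>i\<in>I. w i) + exp (- \<eta> * real k) * real (card U)
           + b * (\<Sum>T\<in>U. (1 - wdegree I E w T)\<^sup>2) + \<gamma> / 2 * real (card U))"
    by blast
  have "\<exists>J Z. J \<subseteq> I \<and> Z \<subseteq> U \<and> U \<subseteq> Z \<union> (\<Union>i\<in>J. E i) \<and>
         real (card J) + real (card Z) \<le> (1 + \<gamma>) * (\<Sum>i\<in>I. w i) + \<gamma> * real (card U)"
    if wh: "weighted_hypergraph U I E w r 1 \<delta>" and d: "\<forall>T\<in>U. wdegree I E w T = 1"
    for U :: "'x set" and I :: "'i set" and E w
  proof -
    interpret weighted_hypergraph U I E w r 1 \<delta> by fact
    obtain J Z where JZ: "J \<subseteq> I" "Z \<subseteq> U" "U \<subseteq> Z \<union> (\<Union>i\<in>J. E i)" and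
      le: "real (card J) + real (card Z) \<le> (1 + \<eta>) * (\<Sum>i\<in>I. w i) + exp (- \<eta> * real k) * real (card U)
           + b * (\<Sum>T\<in>U. (1 - wdegree I E w T)\<^sup>2) + \<gamma> / 2 * real (card U)"
      using *[OF wh] by (elim exE conjE)
    have "(\<Sum>T\<in>U. (1 - wdegree I E w T)\<^sup>2) = 0" using d by simp
    moreover have "exp (- \<eta> * real k) * real (card U) \<le> \<gamma> / 2 * real (card U)"
      using k by (intro mult_right_mono) auto
    moreover have "(1 + \<eta>) * (\<Sum>i\<in>I. w i) \<le> (1 + \<gamma>) * (\<Sum>i\<in>I. w i)"
      using \<eta> w_nonneg by (intro mult_right_mono sum_nonneg) auto
    ultimately have "real (card J) + real (card Z) \<le> (1 + \<gamma>) * (\<Sum>i\<in>I. w i) + \<gamma> * real (card U)"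
      using le by simp
    then show ?thesis using JZ by (intro exI[of _ J] exI[of _ Z] conjI)
  qed
  then show ?thesis using \<open>\<delta> > 0\<close> by (intro exI[of _ \<delta>] conjI allI impI) simp_all
qed

subsection \<open>Clique covers\<close>

lemma cov_le_card:
  assumes V: "simple_graph V E" and \<K>: "\<K> \<subseteq> cliques V E"
    and cover: "\<And>T. T \<in> cliques_of_size t V E \<Longrightarrow> \<exists>K\<in>\<K>. T \<subseteq> K"
  shows "cov t V E \<le> card \<K>"
proof -
  have fin: "finite (cliques V E)" using V by (auto simp: simple_graph_def intro: finite_cliques)
  let ?f = "\<lambda>K. of_bool (K \<in> \<K>) :: nat"
  have "clique_cover t V E ?f"
    unfolding clique_cover_def
  proof (intro conjI ballI)
    fix T assume "T \<in> cliques_of_size t V E"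
    then obtain K where K: "K \<in> \<K>" "T \<subseteq> K" using cover by blast
    have "?f K \<le> (\<Sum>K | K \<in> cliques V E \<and> T \<subseteq> K. ?f K)"
      using K \<K> fin by (intro member_le_sum) auto
    then show "1 \<le> (\<Sum>K | K \<in> cliques V E \<and> T \<subseteq> K. ?f K)" using K by simp
  qed auto
  then have "cov t V E \<le> (\<Sum>K\<in>cliques V E. ?f K)" by (rule cov_le)
  also have "\<dots> = card (cliques V E \<inter> {K. K \<in> \<K>})"
    using fin by simp
  also have "cliques V E \<inter> {K. K \<in> \<K>} = \<K>" using \<K> by auto
  finally show ?thesis .
qed

section \<open>The lower bound for the Turan graph\<close>

lemma turan_clique_inj:
  assumes "clique K (turan_edges n t)"
  shows "inj_on (\<lambda>v. v mod t) K"
proof (rule inj_onI, rule ccontr)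
  fix u v assume uv: "u \<in> K" "v \<in> K" "u mod t = v mod t" "u \<noteq> v"
  then have "{u, v} \<in> turan_edges n t" using assms by (auto simp: clique_def)
  then show False using uv by (auto simp: turan_edges_def doubleton_eq_iff)
qed

lemma cov_turan_ge:
  assumes t: "t \<ge> 1"
  shows "(n div t) ^ t \<le> cov t {..<n} (turan_edges n t)"
proof -
  let ?V = "{..<n}" and ?E = "turan_edges n t"
  let ?\<T> = "cliques_of_size t ?V ?E"
  have fin: "finite (cliques ?V ?E)" by (simp add: finite_cliques)
  have finT: "finite ?\<T>" by (simp add: finite_cliques_of_size)
  \<comment> \<open>The vertex \<open>i + t * g i\<close> is number \<open>g i\<close>, counted from
    0, in the residue class of \<open>i\<close>. Every class has at least \<open>n div t\<close>
    vertices, so each \<open>g\<close> picks a transversal.\<close>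
  define \<phi> where "\<phi> g = (\<lambda>i. i + t * g i) ` {..<t}" for g :: "nat \<Rightarrow> nat"
  let ?P = "{..<t} \<rightarrow>\<^sub>E {..<n div t}"
  have mem: "\<phi> g \<in> ?\<T>" if g: "g \<in> ?P" for g
  proof -
    have lt: "i + t * g i < n" if "i < t" for i
    proof -
      have "g i < n div t" using g that by (auto simp: PiE_def Pi_def)
      then have "t * (g i + 1) \<le> t * (n div t)" by (intro mult_le_mono2) simp
      also have "\<dots> \<le> n" by simp
      finally show ?thesis using that by simp
    qed
    have inj: "inj_on (\<lambda>i. i + t * g i) {..<t}"
      by (rule inj_onI) (metis lessThan_iff mod_less mod_mult_self2)
    have "clique (\<phi> g) ?E"
      unfolding clique_def
    proof (intro ballI impI)
      fix u v assume "u \<in> \<phi> g" "v \<in> \<phi> g" "u \<noteq> v"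
      then obtain i j where ij: "i < t" "j < t" "u = i + t * g i" "v = j + t * g j" "i \<noteq> j"
        by (auto simp: \<phi>_def)
      then have "u < n \<and> v < n \<and> u mod t \<noteq> v mod t" using lt by simp
      then show "{u, v} \<in> ?E" unfolding turan_edges_def by blast
    qed
    moreover have "\<phi> g \<noteq> {}" "\<phi> g \<subseteq> ?V" using t lt by (auto simp: \<phi>_def lessThan_empty_iff)
    moreover have "card (\<phi> g) = t" unfolding \<phi>_def using card_image[OF inj] by simp
    ultimately show ?thesis by (simp add: cliques_of_size_def cliques_def)
  qed
  have inj: "inj_on \<phi> ?P"
  proof (rule inj_onI)
    fix g h assume g: "g \<in> ?P" and h: "h \<in> ?P" and eq: "\<phi> g = \<phi> h"
    show "g = h"
    proof (rule PiE_ext[OF g h])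
      fix i assume i: "i \<in> {..<t}"
      then have "i + t * g i \<in> \<phi> h" using eq unfolding \<phi>_def by blast
      then obtain j where j: "j < t" "i + t * g i = j + t * h j" by (auto simp: \<phi>_def)
      then have "(i + t * g i) mod t = (j + t * h j) mod t" by simp
      then have "i = j" using i j(1) by simp
      then show "g i = h i" using j t by simp
    qed
  qed
  have "(n div t) ^ t = card ?P" by (simp add: card_PiE)
  also have "\<dots> = card (\<phi> ` ?P)" using card_image[OF inj] by simp
  also have "\<dots> \<le> card ?\<T>" using mem finT by (intro card_mono) auto
  also have "\<dots> \<le> cov t ?V ?E"
  proof -
    obtain f where f: "clique_cover t ?V ?E f" and cov: "cov t ?V ?E = (\<Sum>K\<in>cliques ?V ?E. f K)"
      using cov_attained[OF simple_graph_turan] by blast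
    have "1 \<le> f T" if T: "T \<in> ?\<T>" for T
    proof -
      have "{K. K \<in> cliques ?V ?E \<and> T \<subseteq> K} = {T}"
      proof
        show "{K. K \<in> cliques ?V ?E \<and> T \<subseteq> K} \<subseteq> {T}"
        proof
          fix K assume K: "K \<in> {K. K \<in> cliques ?V ?E \<and> T \<subseteq> K}"
          then have finK: "finite K" by (auto simp: cliques_def intro: finite_subset)
          have "inj_on (\<lambda>v. v mod t) K" using K by (auto simp: cliques_def intro: turan_clique_inj)
          then have "card K = card ((\<lambda>v. v mod t) ` K)" by (rule card_image[symmetric])
          also have "\<dots> \<le> card {..<t}" using t by (intro card_mono) auto
          finally have "card K \<le> card T" using T by (simp add: cliques_of_size_def)
          then show "K \<in> {T}" using K finK card_seteq[of K T] by auto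
        qed
        show "{T} \<subseteq> {K. K \<in> cliques ?V ?E \<and> T \<subseteq> K}" using T by (simp add: cliques_of_size_def)
      qed
      moreover have "1 \<le> (\<Sum>K | K \<in> cliques ?V ?E \<and> T \<subseteq> K. f K)"
        using f T by (simp add: clique_cover_def)
      ultimately show ?thesis by simp
    qed
    then have "card ?\<T> \<le> (\<Sum>T\<in>?\<T>. f T)"
      using sum_mono[of ?\<T> "\<lambda>_. 1" f] by simp
    also have "\<dots> \<le> (\<Sum>K\<in>cliques ?V ?E. f K)"
      using fin by (intro sum_mono2) (auto simp: cliques_of_size_def)
    finally show ?thesis using cov by simp
  qed
  finally show ?thesis .
qed

section \<open>The hypergraph of sampled fractional covers\<close>

lemma card_nsets_superset:
  assumes V: "finite V" and A: "A \<subseteq> V" "card A \<le> M"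
  shows "card {S \<in> nsets V M. A \<subseteq> S} = (card V - card A) choose (M - card A)"
proof -
  have finA: "finite A" using A V finite_subset by blast
  have "bij_betw (\<lambda>S. S - A) {S \<in> nsets V M. A \<subseteq> S} (nsets (V - A) (M - card A))"
  proof (rule bij_betw_byWitness[where f' = "\<lambda>S. S \<union> A"])
    show "(\<lambda>S. S - A) ` {S \<in> nsets V M. A \<subseteq> S} \<subseteq> nsets (V - A) (M - card A)"
      using finA by (auto simp: nsets_def card_Diff_subset)
    show "(\<lambda>S. S \<union> A) ` nsets (V - A) (M - card A) \<subseteq> {S \<in> nsets V M. A \<subseteq> S}"
    proof clarify
      fix S assume S: "S \<in> nsets (V - A) (M - card A)"
      then have "card (S \<union> A) = card S + card A"
        using finA by (intro card_Un_disjoint) (auto simp: nsets_def)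
      then show "S \<union> A \<in> nsets V M \<and> A \<subseteq> S \<union> A"
        using S A finA by (auto simp: nsets_def)
    qed
  qed (auto simp: nsets_def)
  then have "card {S \<in> nsets V M. A \<subseteq> S} = card (nsets (V - A) (M - card A))"
    by (rule bij_betw_same_card)
  also have "\<dots> = (card V - card A) choose (M - card A)"
    using A finA by (simp add: card_Diff_subset)
  finally show ?thesis .
qed

text \<open>Compared with \<open>(n / M) ^ t\<close> this loses the factor
  \<open>(M / (M - t)) ^ t\<close>, which is close to 1 for large \<open>M\<close>.\<close>

lemma binomial_ratio_le:
  assumes "t < M"
  shows "real (n choose t) / real (M choose t) \<le> (real n / real (M - t)) ^ t"
proof -
  have M: "real (M - t) ^ t \<le> fact t * real (M choose t)"
  proof -
    have "real (M - t) ^ t = (\<Prod>i = 0..<t. real M - real t)" using assms by (simp add: of_nat_diff)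
    also have "\<dots> \<le> (\<Prod>i = 0..<t. real M - real i)" using assms by (intro prod_mono) auto
    also have "\<dots> = fact t * real (M choose t)"
      by (simp add: binomial_gbinomial gbinomial_mult_fact)
    finally show ?thesis .
  qed
  have "real ((n choose t) * fact t) \<le> real (n ^ t)"
    using binomial_fact_pow[of n t] by (simp only: of_nat_le_iff)
  then have n: "fact t * real (n choose t) \<le> real n ^ t" by (simp add: mult.commute)
  have pos: "real (M - t) ^ t > 0" using assms by simp
  have "real (n choose t) / real (M choose t) = (fact t * real (n choose t)) / (fact t * real (M choose t))"
    by simp
  also have "\<dots> \<le> real n ^ t / real (M - t) ^ t"
    using n M pos by (intro frac_le) auto
  finally show ?thesis by (simp add: power_divide)
qed

text \<open>Turns products of binomial coefficients into quotients: the absorption identity for the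
  codegrees, and \<open>choose_mult\<close> for the total weight.\<close>

lemma ratio_eq:
  fixes m N B D s c :: real
  assumes "m * D = N * B" "N > 0" "D > 0" "c > 0"
  shows "B * s / (c * D) = s / c * (m / N)"
proof -
  have "B = m * D / N" using assms by (simp add: eq_divide_eq mult.commute)
  then show ?thesis using assms(2-4) by (simp only:) (simp add: field_simps)
qed

text \<open>Distinct \<open>t\<close>-cliques span at least \<open>t + 1\<close> vertices, so only a fraction of order \<open>1 / n\<close> of the
  samples containing one of them contains the other.\<close>

lemma sample_hypergraph:
  fixes V :: "'a set"
  assumes V: "simple_graph V E" "card V = n" and t: "1 \<le> t" "t < M" "M \<le> n" and c: "c \<ge> 1"
    and cover: "\<forall>S :: 'a set. finite S \<and> card S = M \<longrightarrow>
        (\<exists>K. (\<forall>i<s. K i \<in> cliques S E) \<and>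
           (\<forall>T \<in> cliques_of_size t S E. c \<le> card {i. i < s \<and> T \<subseteq> K i}))"
  shows "\<exists>(I :: ('a set \<times> nat) set) H w K.
    weighted_hypergraph (cliques_of_size t V E) I H w (2 ^ M) 1 (real s / real c * (real (M - t) / real (n - t))) \<and>
    (\<forall>T \<in> cliques_of_size t V E. wdegree I H w T = 1) \<and>
    (\<forall>i\<in>I. K i \<in> cliques V E \<and> (\<forall>T\<in>H i. T \<subseteq> K i)) \<and>
    (\<Sum>i\<in>I. w i) \<le> real s / real c * (real (n choose t) / real (M choose t))"
proof -
  let ?U = "cliques_of_size t V E"
  have finV: "finite V" using V by (simp add: simple_graph_def)
  have finU: "finite ?U" using finV by (rule finite_cliques_of_size)
  have "\<forall>S\<in>nsets V M. \<exists>K. (\<forall>i<s. K i \<in> cliques S E) \<and>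
           (\<forall>T \<in> cliques_of_size t S E. c \<le> card {i. i < s \<and> T \<subseteq> K i})"
    using cover by (auto simp: nsets_def)
  then obtain K where K: "\<And>S i. S \<in> nsets V M \<Longrightarrow> i < s \<Longrightarrow> K S i \<in> cliques S E"
      and Kc: "\<And>S T. S \<in> nsets V M \<Longrightarrow> T \<in> cliques_of_size t S E \<Longrightarrow> c \<le> card {i. i < s \<and> T \<subseteq> K S i}"
    by metis
  have US: "T \<in> cliques_of_size t S E" if "T \<in> ?U" "T \<subseteq> S" for T S
    using that by (auto simp: cliques_of_size_def cliques_def)
  have "\<exists>Q. Q \<subseteq> {i. i < s \<and> T \<subseteq> K S i} \<and> card Q = c" if "T \<in> ?U" "T \<subseteq> S" "S \<in> nsets V M" for S T
    using obtain_subset_with_card_n[OF Kc[OF that(3) US[OF that(1,2)]]] by metis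
  note Q = this
  \<comment> \<open>Discarding all but exactly \<open>c\<close> of the cliques through \<open>T\<close> makes every degree exactly 1.\<close>
  define P where "P S T = (SOME Q. Q \<subseteq> {i. i < s \<and> T \<subseteq> K S i} \<and> card Q = c)" for S T
  have P: "P S T \<subseteq> {i. i < s \<and> T \<subseteq> K S i} \<and> card (P S T) = c"
    if "T \<in> ?U" "T \<subseteq> S" "S \<in> nsets V M" for S T
    unfolding P_def by (rule someI_ex) (rule Q[OF that])
  have P_mem: "i < s \<and> T \<subseteq> K S i" if "i \<in> P S T" "T \<in> ?U" "T \<subseteq> S" "S \<in> nsets V M" for i S T
    using P[OF that(2-4)] that(1) by blast
  \<comment> \<open>A hyperedge belongs to a slot \<open>(S, i)\<close> rather than to a clique,
    since the same clique may fill several slots. It collects only the t-cliques that count this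
    slot among their \<open>c\<close> chosen ones.\<close>
  define H where "H = (\<lambda>(S, i). {T \<in> ?U. T \<subseteq> S \<and> i \<in> P S T})"
  define I where "I = {x \<in> nsets V M \<times> {..<s}. H x \<noteq> {}}"
  \<comment> \<open>The number of slots that count a given t-clique: \<open>c\<close> in each
    \<open>M\<close>-subset containing it. Weight \<open>1 / d\<close> therefore normalises all
    degrees to 1.\<close>
  define d where "d = c * ((n - t) choose (M - t))"
  define w where "w = (\<lambda>_ :: 'a set \<times> nat. 1 / real d)"
  have d: "real d > 0" using c t by (simp add: d_def)
  have finN: "finite (nsets V M)" using finV by (rule finite_imp_finite_nsets)
  have finI: "finite I" unfolding I_def using finN by simp
  have card_T: "finite T" "card T = t" "T \<subseteq> V" if "T \<in> ?U" for T
    using that finV by (auto simp: cliques_of_size_def cliques_def intro: finite_subset)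
  have deg: "wdegree I H w T = 1" if T: "T \<in> ?U" for T
  proof -
    have "{x \<in> I. T \<in> H x} = (SIGMA S:{S \<in> nsets V M. T \<subseteq> S}. P S T)"
      using T by (auto simp: I_def H_def dest: P_mem)
    moreover have "card (SIGMA S:{S \<in> nsets V M. T \<subseteq> S}. P S T) = (\<Sum>S | S \<in> nsets V M \<and> T \<subseteq> S. card (P S T))"
    proof (rule card_SigmaI)
      show "finite {S \<in> nsets V M. T \<subseteq> S}" using finN by simp
      show "\<forall>S\<in>{S \<in> nsets V M. T \<subseteq> S}. finite (P S T)"
      proof
        fix S assume "S \<in> {S \<in> nsets V M. T \<subseteq> S}"
        then have "P S T \<subseteq> {..<s}" using T by (auto dest: P_mem)
        then show "finite (P S T)" by (rule finite_subset) simp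
      qed
    qed
    moreover have "(\<Sum>S | S \<in> nsets V M \<and> T \<subseteq> S. card (P S T)) = (\<Sum>S | S \<in> nsets V M \<and> T \<subseteq> S. c)"
      using P[OF T] by (intro sum.cong refl) blast
    moreover have "\<dots> = card {S \<in> nsets V M. T \<subseteq> S} * c" by simp
    moreover have "card {S \<in> nsets V M. T \<subseteq> S} = (n - t) choose (M - t)"
      using card_nsets_superset[OF finV card_T(3)[OF T], of M] card_T(2)[OF T] V t by simp
    ultimately have "card {x \<in> I. T \<in> H x} = d" by (simp add: d_def)
    then show ?thesis using d by (simp add: wdegree_def w_def)
  qed
  have codeg: "(\<Sum>x | x \<in> I \<and> T \<in> H x \<and> T' \<in> H x. w x) \<le> real s / real c * (real (M - t) / real (n - t))"
    if T: "T \<in> ?U" and T': "T' \<in> ?U" and ne: "T \<noteq> T'" for T T'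
  proof -
    have "\<not> T' \<subseteq> T" using card_subset_eq[of T T'] card_T[OF T] card_T[OF T'] ne by auto
    then obtain v where v: "v \<in> T'" "v \<notin> T" by auto
    let ?A = "insert v T" and ?B = "(n - t - 1) choose (M - t - 1)"
    have cA: "card ?A = t + 1" using v card_T[OF T] by simp
    have AV: "?A \<subseteq> V" using v card_T[OF T] card_T[OF T'] by auto
    have "{x \<in> I. T \<in> H x \<and> T' \<in> H x} \<subseteq> {S \<in> nsets V M. ?A \<subseteq> S} \<times> {..<s}"
      using v by (auto simp: I_def H_def)
    then have "card {x \<in> I. T \<in> H x \<and> T' \<in> H x} \<le> card ({S \<in> nsets V M. ?A \<subseteq> S} \<times> {..<s})"
      using finN by (intro card_mono) auto
    also have "\<dots> = ?B * s"
      using card_nsets_superset[OF finV AV, of M] cA V t by (simp add: card_cartesian_product)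
    finally have "card {x \<in> I. T \<in> H x \<and> T' \<in> H x} \<le> ?B * s" .
    then have "real (card {x \<in> I. T \<in> H x \<and> T' \<in> H x}) \<le> real (?B * s)" by (simp only: of_nat_le_iff)
    then have "(\<Sum>x | x \<in> I \<and> T \<in> H x \<and> T' \<in> H x. w x) \<le> real (?B * s) / real d"
      using d by (simp add: w_def divide_right_mono)
    also have "\<dots> = real s / real c * (real (M - t) / real (n - t))"
    proof -
      have "(M - t) * ((n - t) choose (M - t)) = (n - t) * ?B"
        using t by (intro times_binomial_minus1_eq) simp
      then have "real (M - t) * real ((n - t) choose (M - t)) = real (n - t) * real ?B"
        by (simp only: flip: of_nat_mult)
      moreover have "real (n - t) > 0" "real ((n - t) choose (M - t)) > 0" "real c > 0" using t c by auto
      ultimately show ?thesis unfolding d_def of_nat_mult by (rule ratio_eq)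
    qed
    finally show ?thesis .
  qed
  have wh: "weighted_hypergraph ?U I H w (2 ^ M) 1 (real s / real c * (real (M - t) / real (n - t)))"
  proof
    show "finite ?U" "finite I" by fact+
    show "0 \<le> real s / real c * (real (M - t) / real (n - t))" by simp
    fix x assume x: "x \<in> I"
    show "H x \<subseteq> ?U" by (auto simp: H_def split: prod.splits)
    show "H x \<noteq> {}" using x by (simp add: I_def)
    show "w x \<ge> 0" by (simp add: w_def)
    have S: "finite (fst x)" "card (fst x) = M" using x by (auto simp: I_def nsets_def)
    have "H x \<subseteq> Pow (fst x)" by (auto simp: H_def split: prod.splits)
    then have "card (H x) \<le> card (Pow (fst x))" using S by (intro card_mono) auto
    then show "card (H x) \<le> 2 ^ M" using S by (simp add: card_Pow)
  next
    fix T assume "T \<in> ?U"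
    then show "wdegree I H w T \<le> 1" using deg by simp
  qed (rule codeg)
  have KV: "K (fst x) (snd x) \<in> cliques V E \<and> (\<forall>T\<in>H x. T \<subseteq> K (fst x) (snd x))" if x: "x \<in> I" for x
  proof -
    obtain S i where [simp]: "x = (S, i)" by (cases x)
    have Si: "S \<in> nsets V M" "i < s" using x by (auto simp: I_def)
    have "T \<subseteq> K S i" if "T \<in> H x" for T
      using that Si by (auto simp: H_def dest: P_mem)
    moreover have "K S i \<in> cliques V E"
      using K[OF Si] Si by (auto simp: cliques_def nsets_def)
    ultimately show ?thesis by simp
  qed
  have "card I \<le> card (nsets V M \<times> {..<s})" unfolding I_def using finN by (intro card_mono) auto
  also have "\<dots> = (n choose M) * s" using V by (simp add: card_cartesian_product)
  finally have "real (card I) \<le> real ((n choose M) * s)" by (simp only: of_nat_le_iff)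
  then have "(\<Sum>x\<in>I. w x) \<le> real ((n choose M) * s) / real d"
    using d by (simp add: w_def divide_right_mono)
  also have "\<dots> = real s / real c * (real (n choose t) / real (M choose t))"
  proof -
    have "(n choose M) * (M choose t) = (n choose t) * ((n - t) choose (M - t))"
      using t by (intro choose_mult) auto
    then have "real (n choose M) * real (M choose t) = real (n choose t) * real ((n - t) choose (M - t))"
      by (simp only: flip: of_nat_mult)
    then have "real (n choose t) * real ((n - t) choose (M - t)) = real (M choose t) * real (n choose M)"
      by (simp add: mult.commute)
    moreover have "real (M choose t) > 0" "real ((n - t) choose (M - t)) > 0" "real c > 0" using t c by auto
    ultimately show ?thesis unfolding d_def of_nat_mult by (rule ratio_eq)
  qed
  finally have F: "(\<Sum>x\<in>I. w x) \<le> real s / real c * (real (n choose t) / real (M choose t))" .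
  show ?thesis
    using wh deg KV F
    by (intro exI[of _ I] exI[of _ H] exI[of _ w] exI[of _ "\<lambda>x. K (fst x) (snd x)"] conjI ballI) simp_all
qed

section \<open>Assembling the asymptotic bound\<close>

lemma eventually_power_Suc_inverse_le:
  fixes \<epsilon> :: real
  assumes "\<epsilon> > 0"
  shows "\<exists>N0\<ge>1. \<forall>N\<ge>N0. (1 + 1 / real N) ^ t \<le> 1 + \<epsilon>"
proof -
  have "(\<lambda>N. (1 + 1 / real N) ^ t) \<longlonglongrightarrow> (1 + 0) ^ t"
    by (intro tendsto_intros lim_1_over_n)
  then have "\<forall>\<^sub>F N in sequentially. (1 + 1 / real N) ^ t < 1 + \<epsilon>"
    by (rule order_tendstoD) (use assms in simp)
  then obtain N0 where "\<And>N. N \<ge> N0 \<Longrightarrow> (1 + 1 / real N) ^ t < 1 + \<epsilon>"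
    unfolding eventually_sequentially by blast
  then show ?thesis by (intro exI[of _ "max 1 N0"]) (auto intro: less_imp_le)
qed

lemma cov_upper_bound:
  assumes t: "t \<ge> 1" and \<epsilon>: "0 < \<epsilon>" "\<epsilon> \<le> (1::real)"
  shows "\<exists>n0. \<forall>n\<ge>n0. \<forall>(V :: 'a set) E. simple_graph V E \<and> card V = n \<longrightarrow>
     real (cov t V E) \<le> (1 + 8 * \<epsilon>) * (real n / real t) ^ t"
proof -
  obtain N where N: "N \<ge> 1" "(1 + 1 / real N) ^ t \<le> 1 + \<epsilon>"
    using eventually_power_Suc_inverse_le[OF \<epsilon>(1)] by blast
  \<comment> \<open>Chosen so that \<open>M / (M - t)\<close> equals
    \<open>1 + 1 / N\<close>.\<close>
  define M where "M = t * (N + 1)"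
  have M: "t < M" "M - t = t * N" using t N by (auto simp: M_def)
  obtain s c where c: "c \<ge> 1" and sc: "real s \<le> (1 + \<epsilon>) * (real M / real t) ^ t * real c"
    and cover: "\<forall>(S :: 'a set) E. finite S \<and> card S = M \<longrightarrow>
        (\<exists>K. (\<forall>i<s. K i \<in> cliques S E) \<and>
           (\<forall>T \<in> cliques_of_size t S E. c \<le> card {i. i < s \<and> T \<subseteq> K i}))"
    using fractional_cover[OF t less_imp_le[OF M(1)] \<epsilon>(1), where 'a = 'a] by (elim exE conjE)
  \<comment> \<open>There are at most \<open>n ^ t\<close> t-cliques, so an error of \<gamma> for
    each of them totals at most \<open>\<epsilon> * (n / t) ^ t\<close>.\<close>
  define \<gamma> where "\<gamma> = \<epsilon> / real t ^ t"
  have tt: "real t ^ t \<ge> 1" using t by simp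
  have "\<epsilon> * 1 \<le> \<epsilon> * real t ^ t" using tt \<epsilon> by (intro mult_left_mono) auto
  then have \<gamma>: "\<gamma> > 0" "\<gamma> \<le> \<epsilon>" using \<epsilon> t unfolding \<gamma>_def by (simp_all add: divide_le_eq)
  obtain \<delta> where \<delta>: "\<delta> > 0" and nib: "\<forall>U I E w. weighted_hypergraph (U :: 'a set set) (I :: ('a set \<times> nat) set) E w (2 ^ M) 1 \<delta> \<and>
      (\<forall>T\<in>U. wdegree I E w T = 1) \<longrightarrow>
      (\<exists>J Z. J \<subseteq> I \<and> Z \<subseteq> U \<and> U \<subseteq> Z \<union> (\<Union>i\<in>J. E i) \<and>
         real (card J) + real (card Z) \<le> (1 + \<gamma>) * (\<Sum>i\<in>I. w i) + \<gamma> * real (card U))"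
    using nibble[OF \<gamma>(1), of "2 ^ M", where 'x = "'a set" and 'i = "'a set \<times> nat"] by (elim exE conjE)
  \<comment> \<open>From \<open>n - t \<ge> n1\<close> on, the codegree bound of the sampled
    hypergraph is at most \<delta>. Adding \<open>M\<close> to the threshold ensures this as well as
    \<open>M \<le> n\<close>.\<close>
  obtain n1 :: nat where n1: "real s / real c * real (M - t) / \<delta> \<le> real n1" using real_arch_simple by blast
  have "real (cov t V E) \<le> (1 + 8 * \<epsilon>) * (real n / real t) ^ t"
    if n: "n \<ge> n1 + M" and G: "simple_graph V E" "card V = n" for n and V :: "'a set" and E
  proof -
    let ?U = "cliques_of_size t V E"
    have finV: "finite V" using G by (simp add: simple_graph_def)
    have nM: "M \<le> n" using n by simp
    have "\<forall>S :: 'a set. finite S \<and> card S = M \<longrightarrow> (\<exists>K. (\<forall>i<s. K i \<in> cliques S E) \<and>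
           (\<forall>T \<in> cliques_of_size t S E. c \<le> card {i. i < s \<and> T \<subseteq> K i}))"
      using cover by blast
    from sample_hypergraph[OF G t M(1) nM c this]
    obtain I :: "('a set \<times> nat) set" and H w K where
      wh: "weighted_hypergraph ?U I H w (2 ^ M) 1 (real s / real c * (real (M - t) / real (n - t)))"
      and deg: "\<forall>T \<in> ?U. wdegree I H w T = 1"
      and K: "\<forall>i\<in>I. K i \<in> cliques V E \<and> (\<forall>T\<in>H i. T \<subseteq> K i)"
      and F: "(\<Sum>i\<in>I. w i) \<le> real s / real c * (real (n choose t) / real (M choose t))"
      by (elim exE conjE)
    have nt: "n1 \<le> n - t" "n - t > 0" using n M(1) by linarith+
    then have pos: "real (n - t) > 0" by simp
    have "real n1 \<le> real (n - t)" using nt(1) by (simp only: of_nat_le_iff)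
    then have "real s / real c * real (M - t) / \<delta> \<le> real (n - t)"
      using n1 by linarith
    then have "real s / real c * real (M - t) \<le> \<delta> * real (n - t)"
      using \<delta> by (simp only: pos_divide_le_eq mult.commute)
    then have "real s / real c * (real (M - t) / real (n - t)) \<le> \<delta>"
      using pos by (simp only: times_divide_eq_right pos_divide_le_eq)
    with wh have "weighted_hypergraph ?U I H w (2 ^ M) 1 \<delta>" by (rule weighted_hypergraph_mono)
    from nib[THEN spec, THEN spec, THEN spec, THEN spec, THEN mp, OF conjI[OF this deg]]
    obtain J Z where JZ: "J \<subseteq> I" "Z \<subseteq> ?U" "?U \<subseteq> Z \<union> (\<Union>i\<in>J. H i)"
      and le: "real (card J) + real (card Z) \<le> (1 + \<gamma>) * (\<Sum>i\<in>I. w i) + \<gamma> * real (card ?U)"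
      by (elim exE conjE)
    have finJ: "finite J" using JZ(1) weighted_hypergraph.finI[OF wh] by (rule finite_subset)
    \<comment> \<open>The selected hyperedges contribute their cliques, and each t-clique left over
      by the nibble is added as a clique of its own.\<close>
    have "cov t V E \<le> card (K ` J \<union> Z)"
    proof (rule cov_le_card[OF G(1)])
      show "K ` J \<union> Z \<subseteq> cliques V E" using JZ K by (auto simp: cliques_of_size_def)
      fix T assume "T \<in> ?U"
      then consider "T \<in> Z" | i where "i \<in> J" "T \<in> H i" using JZ(3) by blast
      then show "\<exists>L\<in>K ` J \<union> Z. T \<subseteq> L"
      proof cases
        case (2 i)
        then have "T \<subseteq> K i" using JZ(1) K by blast
        then show ?thesis using 2(1) by blast
      qed blast
    qed
    also have "\<dots> \<le> card (K ` J) + card Z" by (rule card_Un_le)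
    also have "\<dots> \<le> card J + card Z" using card_image_le[OF finJ] by simp
    finally have "real (cov t V E) \<le> real (card J) + real (card Z)" by linarith
    also note le
    finally have cov: "real (cov t V E) \<le> (1 + \<gamma>) * (\<Sum>i\<in>I. w i) + \<gamma> * real (card ?U)" .
    let ?x = "(real n / real t) ^ t"
    have x0: "?x \<ge> 0" by simp
    have "?U \<subseteq> nsets V t" using finV by (auto simp: cliques_of_size_def cliques_def nsets_def intro: finite_subset)
    then have "card ?U \<le> card (nsets V t)" using finV by (intro card_mono finite_imp_finite_nsets)
    also have "\<dots> \<le> n ^ t" using G binomial_le_pow[of t n] M(1) nM by simp
    finally have "real (card ?U) \<le> real (n ^ t)" by (simp only: of_nat_le_iff)
    then have "\<gamma> * real (card ?U) \<le> \<gamma> * real (n ^ t)" using \<gamma> by (intro mult_left_mono) auto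
    also have "\<dots> = \<epsilon> * ?x" by (simp add: \<gamma>_def power_divide)
    finally have U: "\<gamma> * real (card ?U) \<le> \<epsilon> * ?x" .
    have "real s / real c \<le> (1 + \<epsilon>) * (real M / real t) ^ t"
      using sc c by (simp add: divide_le_eq)
    moreover have "real (n choose t) / real (M choose t) \<le> (real n / real (M - t)) ^ t"
      using M(1) by (rule binomial_ratio_le)
    ultimately have "real s / real c * (real (n choose t) / real (M choose t))
        \<le> ((1 + \<epsilon>) * (real M / real t) ^ t) * (real n / real (M - t)) ^ t"
      using \<epsilon> by (intro mult_mono) auto
    also have "\<dots> = (1 + \<epsilon>) * ((1 + 1 / real N) ^ t * ?x)"
    proof -
      have "real M / real t * (real n / real (M - t)) = (1 + 1 / real N) * (real n / real t)"
        unfolding M(2) using t N by (simp add: M_def field_simps)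
      then show ?thesis unfolding mult.assoc power_mult_distrib[symmetric] by simp
    qed
    also have "\<dots> \<le> (1 + \<epsilon>) * ((1 + \<epsilon>) * ?x)"
      using N(2) \<epsilon> x0 by (intro mult_left_mono mult_right_mono) auto
    finally have F': "(\<Sum>i\<in>I. w i) \<le> (1 + \<epsilon>) * ((1 + \<epsilon>) * ?x)" using F by linarith
    have "(1 + \<gamma>) * (\<Sum>i\<in>I. w i) \<le> (1 + \<gamma>) * ((1 + \<epsilon>) * ((1 + \<epsilon>) * ?x))"
      using F' \<gamma> by (intro mult_left_mono) auto
    also have "\<dots> \<le> (1 + \<epsilon>) * ((1 + \<epsilon>) * ((1 + \<epsilon>) * ?x))"
      using \<gamma> \<epsilon> x0 by (intro mult_right_mono) auto
    finally have "real (cov t V E) \<le> ((1 + \<epsilon>) * (1 + \<epsilon>) * (1 + \<epsilon>) + \<epsilon>) * ?x"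
      using cov U by (simp add: algebra_simps)
    \<comment> \<open>The three factors come from the nibble, the fractional covers and the
      sampling, the extra \<epsilon> from the nibble error per t-clique. Since \<epsilon> is at most
      1, the increments add up to at most \<open>(3 + 3 + 1 + 1) * \<epsilon>\<close>.\<close>
    also have "\<dots> \<le> (1 + 8 * \<epsilon>) * ?x"
    proof (intro mult_right_mono x0)
      have "\<epsilon> * \<epsilon> \<le> \<epsilon> * 1" using \<epsilon> by (intro mult_left_mono) auto
      moreover have "\<epsilon> * (\<epsilon> * \<epsilon>) \<le> \<epsilon> * 1" using \<epsilon> mult_mono[of \<epsilon> 1 \<epsilon> 1] by (intro mult_left_mono) auto
      moreover have "(1 + \<epsilon>) * (1 + \<epsilon>) * (1 + \<epsilon>) = 1 + 3 * \<epsilon> + 3 * (\<epsilon> * \<epsilon>) + \<epsilon> * (\<epsilon> * \<epsilon>)"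
        by (simp add: algebra_simps)
      ultimately show "(1 + \<epsilon>) * (1 + \<epsilon>) * (1 + \<epsilon>) + \<epsilon> \<le> 1 + 8 * \<epsilon>" using \<epsilon> by linarith
    qed
    finally show ?thesis .
  qed
  then show ?thesis by blast
qed

theorem theorem1p6:
  fixes t :: nat
  assumes "t \<ge> 2"
  shows "\<forall>\<epsilon>::real. \<epsilon> > 0 \<longrightarrow> (\<exists>n\<^sub>0. \<forall>n\<ge>n\<^sub>0. \<forall>(V :: 'a set) E.
           simple_graph V E \<and> card V = n \<longrightarrow>
           real (cov t V E) \<le> (1 + \<epsilon>) * real (cov t {..<n} (turan_edges n t)))"
proof (intro allI impI)
  fix \<epsilon> :: real assume \<epsilon>: "\<epsilon> > 0"
  \<comment> \<open>With \<open>e \<le> 1\<close>, the product \<open>(1 + 8 * e) * (1 + e)\<close>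
    is at most \<open>1 + 17 * e\<close>, which 32 covers with room to spare.\<close>
  define e where "e = min 1 (\<epsilon> / 32)"
  have e: "0 < e" "e \<le> 1" "32 * e \<le> \<epsilon>" using \<epsilon> by (auto simp: e_def)
  have t: "t \<ge> 1" using assms by simp
  obtain n1 where n1: "\<forall>n\<ge>n1. \<forall>(V :: 'a set) E. simple_graph V E \<and> card V = n \<longrightarrow>
     real (cov t V E) \<le> (1 + 8 * e) * (real n / real t) ^ t"
    using cov_upper_bound[OF t e(1,2), where 'a = 'a] by blast
  obtain N where N: "N \<ge> 1" "\<And>q. q \<ge> N \<Longrightarrow> (1 + 1 / real q) ^ t \<le> 1 + e"
    using eventually_power_Suc_inverse_le[OF e(1)] by blast
  have "real (cov t V E) \<le> (1 + \<epsilon>) * real (cov t {..<n} (turan_edges n t))"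
    if n: "n \<ge> n1 + t * N" and G: "simple_graph V E \<and> card V = n" for n and V :: "'a set" and E
  proof -
    let ?q = "n div t"
    \<comment> \<open>The Turan bound uses \<open>n div t\<close> in place of \<open>n / t\<close>.
      As \<open>n / t \<le> ?q + 1\<close>, the rounding costs \<open>(1 + 1 / ?q) ^ t\<close>, at
      most \<open>1 + e\<close> once \<open>?q\<close> reaches \<open>N\<close>.\<close>
    have q: "N \<le> ?q" using n t by (simp add: less_eq_div_iff_mult_less_eq mult.commute)
    have q0: "real ?q > 0" using q N(1) by linarith
    have "n \<le> t * ?q + t" using mod_less_divisor[of t n] t mult_div_mod_eq[of t n] by linarith
    then have "real n \<le> real (t * ?q + t)" by (simp only: of_nat_le_iff)
    then have "real n / real t \<le> real ?q + 1" using t by (simp add: field_simps)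
    also have "\<dots> = real ?q * (1 + 1 / real ?q)" using q0 by (simp add: field_simps)
    finally have "(real n / real t) ^ t \<le> (real ?q * (1 + 1 / real ?q)) ^ t"
      by (intro power_mono) auto
    also have "\<dots> = (1 + 1 / real ?q) ^ t * real ?q ^ t" by (simp add: power_mult_distrib mult.commute)
    also have "\<dots> \<le> (1 + e) * real ?q ^ t" using N(2)[OF q] by (intro mult_right_mono) auto
    finally have x: "(real n / real t) ^ t \<le> (1 + e) * real ?q ^ t" .
    have "real (cov t V E) \<le> (1 + 8 * e) * (real n / real t) ^ t" using n1 n G by simp
    also have "\<dots> \<le> (1 + 8 * e) * ((1 + e) * real ?q ^ t)" using x e by (intro mult_left_mono) auto
    also have "\<dots> = ((1 + 8 * e) * (1 + e)) * real ?q ^ t" by simp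
    also have "\<dots> \<le> (1 + \<epsilon>) * real ?q ^ t"
    proof (intro mult_right_mono)
      have "e * e \<le> e * 1" using e by (intro mult_left_mono) auto
      moreover have "(1 + 8 * e) * (1 + e) = 1 + 9 * e + 8 * (e * e)" by (simp add: algebra_simps)
      ultimately show "(1 + 8 * e) * (1 + e) \<le> 1 + \<epsilon>" using e by linarith
    qed simp
    also have "\<dots> \<le> (1 + \<epsilon>) * real (cov t {..<n} (turan_edges n t))"
    proof (intro mult_left_mono)
      have "real (?q ^ t) \<le> real (cov t {..<n} (turan_edges n t))"
        using cov_turan_ge[OF t, of n] by (simp only: of_nat_le_iff)
      then show "real ?q ^ t \<le> real (cov t {..<n} (turan_edges n t))" by simp
    qed (use \<epsilon> in simp)
    finally show ?thesis .
  qed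
  then show "\<exists>n\<^sub>0. \<forall>n\<ge>n\<^sub>0. \<forall>(V :: 'a set) E. simple_graph V E \<and> card V = n \<longrightarrow>
      real (cov t V E) \<le> (1 + \<epsilon>) * real (cov t {..<n} (turan_edges n t))" by blast
qed

end
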